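(* Let $f:M_r\to\mathbb{N}_s$ be an isometric immersion from an $n$-dimensional connected pseudo-Riemannian manifold $M_r$ of index $r$ into an $m$-dimensional pseudo-Riemannian manifold $\mathbb{N}_s$ of index $s$, and suppose $f$ has $3$-planar geodesic normal sections. Let $\gamma$ be a normal section of $M_r$ at a point $p$ in the direction of $X$, with $\gamma'=X$, and let $V_1=X,V_2,V_3$, $\varepsilon_i=\langle V_i,V_i\rangle=\pm1$ and $k_1,k_2$ be the Frenet vectors, their signs, and the first two curvatures of $\gamma$ as a curve in $\mathbb{N}_s$. Then $$(\overline{\nabla}_Xh)(X,X)=\varepsilon_2(Xk_1)V_2+\varepsilon_2\varepsilon_3k_1k_2V_3$$ and $$A_{h(X,X)}X=\varepsilon_1\varepsilon_2k_1^2X.$$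
   Context: Let $\nabla,\widetilde\nabla$ be the Levi-Civita connections of $M_r$ and $\mathbb{N}_s$. The second fundamental form is $h(X,Y)=\widetilde\nabla_XY-\nabla_XY$. For a normal field $\xi$, $\widetilde\nabla_X\xi=-A_\xi X+D_X\xi$, where $A_\xi$ is the shape operator and $D$ is the normal connection; $\langle A_\xi X,Y\rangle=\langle h(X,Y),\xi\rangle$. The covariant derivative of $h$ is $(\overline\nabla_Xh)(Y,Z)=D_Xh(Y,Z)-h(\nabla_XY,Z)-h(Y,\nabla_XZ)$. Normal sections: for $p\in M_r$ and a unit vector $X\in T_pM_r$ ($\langle X,X\rangle=\pm1$), $X$ and the normal space $T_p^\perp M_r$ span an $(m-n+1)$-dimensional subspace $E(p,X)$ of $T_{f(p)}\mathbb{N}_s$, which determines an $(m-n+1)$-dimensional totally geodesic submanifold $W$ of $\mathbb{N}_s$. The intersection of $M_r$ with $W$ gives, near $p$, a curve $\gamma$ called the normal section of $M_r$ at $p$ in the direction of $X$. $M_r$ (or $f$) has $d$-planar normal sections if for each normal section $\gamma$ the derivatives $\gamma',\gamma'',\dots,\gamma^{(d+1)}$ (taken in $\mathbb{N}_s$, i.e. $\gamma''=\widetilde\nabla_XX$, etc.) are linearly dependent as vectors in $W$. It has $d$-planar geodesic normal sections if, in addition, each normal section is a geodesic of $M_r$. Frenet apparatus: along $\gamma$, parametrized with $X=\gamma'$ and $\langle X,X\rangle=\varepsilon_1=\pm1$, the vectors $V_1=X,V_2,V_3$ are orthonormal with $\langle V_i,V_i\rangle=\varepsilon_i=\pm1$,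 $V_2,V_3$ are normal to $M_r$, and $$\widetilde\nabla_XX=h(X,X)=\varepsilon_2k_1V_2,\qquad \widetilde\nabla_XV_2=-\varepsilon_1k_1X+\varepsilon_3k_2V_3.$$ Here $Xk_1$ is the derivative of $k_1$ along $\gamma$. *)

theory Defs
  imports "HOL-Analysis.Analysis"
begin

text \<open>
  Smooth manifolds are modelled on the whole of a Hausdorff, second countable type, with an atlas
  of charts into \<open>real ^ 'n\<close>; the dimension is \<open>CARD('n)\<close>.  Each point \<open>p\<close> carries a distinguished
  chart \<open>chart_at M p\<close> of the atlas, and the tangent space at \<open>p\<close> is \<open>real ^ 'n\<close>: a vector stands
  for the tangent vector having these components in the distinguished chart.  Components with
  respect to any other chart are obtained by the derivative of the coordinate change.
\<close>

text \<open>The set \<open>S\<close> is meant to be open, since derivatives are taken in the full space.\<close>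

primrec C_k_on :: "nat \<Rightarrow> ('a::euclidean_space \<Rightarrow> 'b::real_normed_vector) \<Rightarrow> 'a set \<Rightarrow> bool" where
  "C_k_on 0 f S \<longleftrightarrow> continuous_on S f"
| "C_k_on (Suc k) f S \<longleftrightarrow>
     f differentiable_on S \<and> (\<forall>v. C_k_on k (\<lambda>x. frechet_derivative f (at x) v) S)"

definition smooth_on :: "'a::euclidean_space set \<Rightarrow> ('a \<Rightarrow> 'b::real_normed_vector) \<Rightarrow> bool" where
  "smooth_on S f \<longleftrightarrow> (\<forall>k. C_k_on k f S)"

subsection \<open>Charts and manifolds\<close>

type_synonym ('a, 'n) chart = "'a set \<times> ('a \<Rightarrow> real ^ 'n)"

definition chart_inv :: "('a, 'n) chart \<Rightarrow> real ^ 'n \<Rightarrow> 'a" where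
  "chart_inv c = inv_into (fst c) (snd c)"

definition is_chart :: "('a::topological_space, 'n::finite) chart \<Rightarrow> bool" where
  "is_chart c \<longleftrightarrow> open (fst c) \<and> open (snd c ` fst c) \<and>
     homeomorphism (fst c) (snd c ` fst c) (snd c) (chart_inv c)"

definition coord_change :: "('a, 'n) chart \<Rightarrow> ('a, 'n) chart \<Rightarrow> real ^ 'n \<Rightarrow> real ^ 'n" where
  "coord_change c d = snd d \<circ> chart_inv c"

definition compatible :: "('a, 'n::finite) chart \<Rightarrow> ('a, 'n) chart \<Rightarrow> bool" where
  "compatible c d \<longleftrightarrow>
     smooth_on (snd c ` (fst c \<inter> fst d)) (coord_change c d) \<and>
     smooth_on (snd d ` (fst c \<inter> fst d)) (coord_change d c)"

record ('a, 'n::finite) metric_manifold =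
  atlas :: "('a, 'n) chart set"
  chart_at :: "'a \<Rightarrow> ('a, 'n) chart"
  metric :: "'a \<Rightarrow> real ^ 'n \<Rightarrow> real ^ 'n \<Rightarrow> real"

definition smooth_manifold ::
  "('a::{t2_space, second_countable_topology}, 'n::finite) metric_manifold \<Rightarrow> bool" where
  "smooth_manifold M \<longleftrightarrow>
     (\<forall>c\<in>atlas M. is_chart c) \<and>
     (\<forall>c\<in>atlas M. \<forall>d\<in>atlas M. compatible c d) \<and>
     (\<forall>p. chart_at M p \<in> atlas M \<and> p \<in> fst (chart_at M p))"

definition vector_change ::
  "('a, 'n::finite) chart \<Rightarrow> ('a, 'n) chart \<Rightarrow> 'a \<Rightarrow> real ^ 'n \<Rightarrow> real ^ 'n" where
  "vector_change c d p = frechet_derivative (coord_change c d) (at (snd c p))"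

definition to_chart ::
  "('a, 'n::finite) metric_manifold \<Rightarrow> ('a, 'n) chart \<Rightarrow> 'a \<Rightarrow> real ^ 'n \<Rightarrow> real ^ 'n" where
  "to_chart M c p = vector_change (chart_at M p) c p"

definition from_chart ::
  "('a, 'n::finite) metric_manifold \<Rightarrow> ('a, 'n) chart \<Rightarrow> 'a \<Rightarrow> real ^ 'n \<Rightarrow> real ^ 'n" where
  "from_chart M c p = vector_change c (chart_at M p) p"

subsection \<open>Pseudo-Riemannian metrics\<close>

definition form_index :: "('v::euclidean_space \<Rightarrow> 'v \<Rightarrow> real) \<Rightarrow> nat" where
  "form_index B = Max {dim S | S. subspace S \<and> (\<forall>v\<in>S. v \<noteq> 0 \<longrightarrow> B v v < 0)}"

text \<open>The metric in the coordinates of the chart \<open>c\<close>, at the point with coordinates \<open>x\<close>.\<close>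

definition metric_in ::
  "('a, 'n::finite) metric_manifold \<Rightarrow> ('a, 'n) chart \<Rightarrow> real ^ 'n \<Rightarrow> real ^ 'n \<Rightarrow> real ^ 'n \<Rightarrow> real"
  where
  "metric_in M c x v w =
     metric M (chart_inv c x) (from_chart M c (chart_inv c x) v) (from_chart M c (chart_inv c x) w)"

definition pseudo_riemannian ::
  "('a::{t2_space, second_countable_topology}, 'n::finite) metric_manifold \<Rightarrow> nat \<Rightarrow> bool" where
  "pseudo_riemannian M r \<longleftrightarrow>
     smooth_manifold M \<and>
     (\<forall>p. bilinear (metric M p) \<and>
          (\<forall>v w. metric M p v w = metric M p w v) \<and>
          (\<forall>v. (\<forall>w. metric M p v w = 0) \<longrightarrow> v = 0) \<and>
          form_index (metric M p) = r) \<and>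
     (\<forall>c\<in>atlas M. \<forall>v w. smooth_on (snd c ` fst c) (\<lambda>x. metric_in M c x v w))"

text \<open>
  The Levi-Civita connection at \<open>p\<close>, that is, the unique torsion-free metric connection, through its
  coefficients in the distinguished chart: \<open>\<Gamma> u v\<close> is the covariant derivative in direction \<open>u\<close> of
  the field with constant components \<open>v\<close>.  Such coordinate fields commute, so that vanishing of the
  torsion is the symmetry of \<open>\<Gamma>\<close>, and the last condition is compatibility with the metric.
\<close>

definition levi_civita ::
  "('a, 'n::finite) metric_manifold \<Rightarrow> 'a \<Rightarrow> real ^ 'n \<Rightarrow> real ^ 'n \<Rightarrow> real ^ 'n" where
  "levi_civita M p = (THE \<Gamma>. bilinear \<Gamma> \<and> (\<forall>u v. \<Gamma> u v = \<Gamma> v u) \<and>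
     (\<forall>u v w. frechet_derivative (\<lambda>x. metric_in M (chart_at M p) x v w) (at (snd (chart_at M p) p)) u
        = metric M p (\<Gamma> u v) w + metric M p v (\<Gamma> u w)))"

subsection \<open>Curves, fields along curves and their covariant derivatives\<close>

definition smooth_curve ::
  "('a::topological_space, 'n::finite) metric_manifold \<Rightarrow> real set \<Rightarrow> (real \<Rightarrow> 'a) \<Rightarrow> bool" where
  "smooth_curve M I \<gamma> \<longleftrightarrow> continuous_on I \<gamma> \<and>
     (\<forall>c\<in>atlas M. smooth_on {t\<in>I. \<gamma> t \<in> fst c} (snd c \<circ> \<gamma>))"

definition velocity ::
  "('a, 'n::finite) metric_manifold \<Rightarrow> (real \<Rightarrow> 'a) \<Rightarrow> real \<Rightarrow> real ^ 'n" where
  "velocity M \<gamma> t = vector_derivative (snd (chart_at M (\<gamma> t)) \<circ> \<gamma>) (at t)"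

definition smooth_along ::
  "('a, 'n::finite) metric_manifold \<Rightarrow> real set \<Rightarrow> (real \<Rightarrow> 'a) \<Rightarrow> (real \<Rightarrow> real ^ 'n) \<Rightarrow> bool" where
  "smooth_along M I \<gamma> Y \<longleftrightarrow>
     (\<forall>c\<in>atlas M. smooth_on {t\<in>I. \<gamma> t \<in> fst c} (\<lambda>t. to_chart M c (\<gamma> t) (Y t)))"

text \<open>
  The covariant derivative, in direction of \<open>velocity M \<gamma> t\<close>, of a field \<open>Y\<close> along \<open>\<gamma>\<close>, for the
  Levi-Civita connection.  A vector field on the manifold is differentiated in the direction of a
  tangent vector by restricting it to any curve with that velocity.
\<close>

definition cov_deriv ::
  "('a, 'n::finite) metric_manifold \<Rightarrow> (real \<Rightarrow> 'a) \<Rightarrow> (real \<Rightarrow> real ^ 'n) \<Rightarrow> real \<Rightarrow> real ^ 'n" where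
  "cov_deriv M \<gamma> Y t =
     vector_derivative (\<lambda>s. to_chart M (chart_at M (\<gamma> t)) (\<gamma> s) (Y s)) (at t) +
     levi_civita M (\<gamma> t) (velocity M \<gamma> t) (Y t)"

text \<open>\<open>curve_deriv M \<gamma> i\<close> is the derivative of \<open>\<gamma>\<close> of order \<open>i + 1\<close>.\<close>

primrec curve_deriv ::
  "('a, 'n::finite) metric_manifold \<Rightarrow> (real \<Rightarrow> 'a) \<Rightarrow> nat \<Rightarrow> real \<Rightarrow> real ^ 'n" where
  "curve_deriv M \<gamma> 0 = velocity M \<gamma>"
| "curve_deriv M \<gamma> (Suc i) = cov_deriv M \<gamma> (curve_deriv M \<gamma> i)"

subsection \<open>Isometric immersions\<close>

definition smooth_map ::
  "('a::topological_space, 'n::finite) metric_manifold \<Rightarrow>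
   ('b::topological_space, 'm::finite) metric_manifold \<Rightarrow> ('a \<Rightarrow> 'b) \<Rightarrow> bool" where
  "smooth_map M N f \<longleftrightarrow> continuous_on UNIV f \<and>
     (\<forall>c\<in>atlas M. \<forall>d\<in>atlas N.
        smooth_on (snd c ` (fst c \<inter> f -` fst d)) (snd d \<circ> f \<circ> chart_inv c))"

definition differential ::
  "('a, 'n::finite) metric_manifold \<Rightarrow> ('b, 'm::finite) metric_manifold \<Rightarrow> ('a \<Rightarrow> 'b) \<Rightarrow>
   'a \<Rightarrow> real ^ 'n \<Rightarrow> real ^ 'm" where
  "differential M N f p =
     frechet_derivative (snd (chart_at N (f p)) \<circ> f \<circ> chart_inv (chart_at M p))
       (at (snd (chart_at M p) p))"

definition isometric_immersion ::
  "('a::topological_space, 'n::finite) metric_manifold \<Rightarrow>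
   ('b::topological_space, 'm::finite) metric_manifold \<Rightarrow> ('a \<Rightarrow> 'b) \<Rightarrow> bool" where
  "isometric_immersion M N f \<longleftrightarrow> smooth_map M N f \<and>
     (\<forall>p. inj (differential M N f p) \<and>
        (\<forall>v w. metric N (f p) (differential M N f p v) (differential M N f p w) = metric M p v w))"

definition normal_space ::
  "('a, 'n::finite) metric_manifold \<Rightarrow> ('b, 'm::finite) metric_manifold \<Rightarrow> ('a \<Rightarrow> 'b) \<Rightarrow>
   'a \<Rightarrow> (real ^ 'm) set" where
  "normal_space M N f p = {\<xi>. \<forall>v. metric N (f p) (differential M N f p v) \<xi> = 0}"

definition normal_part ::
  "('a, 'n::finite) metric_manifold \<Rightarrow> ('b, 'm::finite) metric_manifold \<Rightarrow> ('a \<Rightarrow> 'b) \<Rightarrow>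
   'a \<Rightarrow> real ^ 'm \<Rightarrow> real ^ 'm" where
  "normal_part M N f p w =
     (THE \<xi>. \<xi> \<in> normal_space M N f p \<and> w - \<xi> \<in> range (differential M N f p))"

text \<open>
  The second fundamental form \<open>h\<close>: the difference of the two covariant derivatives, for an
  arbitrary extension of the second argument to a field \<open>Y\<close> along a curve tangent to the first.
\<close>

definition second_ff ::
  "('a::topological_space, 'n::finite) metric_manifold \<Rightarrow>
   ('b::topological_space, 'm::finite) metric_manifold \<Rightarrow> ('a \<Rightarrow> 'b) \<Rightarrow>
   'a \<Rightarrow> real ^ 'n \<Rightarrow> real ^ 'n \<Rightarrow> real ^ 'm" where
  "second_ff M N f p v w = (THE u. \<forall>I \<gamma> Y t.
     open I \<and> t \<in> I \<and> smooth_curve M I \<gamma> \<and> \<gamma> t = p \<and> velocity M \<gamma> t = v \<and>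
     smooth_along M I \<gamma> Y \<and> Y t = w \<longrightarrow>
     u = cov_deriv N (f \<circ> \<gamma>) (\<lambda>s. differential M N f (\<gamma> s) (Y s)) t
         - differential M N f p (cov_deriv M \<gamma> Y t))"

text \<open>\<open>shape_op M N f p \<xi> v\<close> is the value at \<open>v\<close> of the shape operator of the normal vector \<open>\<xi>\<close>.\<close>

definition shape_op ::
  "('a::topological_space, 'n::finite) metric_manifold \<Rightarrow>
   ('b::topological_space, 'm::finite) metric_manifold \<Rightarrow> ('a \<Rightarrow> 'b) \<Rightarrow>
   'a \<Rightarrow> real ^ 'm \<Rightarrow> real ^ 'n \<Rightarrow> real ^ 'n" where
  "shape_op M N f p \<xi> v =
     (THE u. \<forall>w. metric M p u w = metric N (f p) (second_ff M N f p v w) \<xi>)"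

text \<open>Here \<open>\<xi>\<close> is a normal field along \<open>f \<circ> \<gamma>\<close>, differentiated in direction \<open>velocity M \<gamma> t\<close>.\<close>

definition normal_deriv ::
  "('a, 'n::finite) metric_manifold \<Rightarrow> ('b, 'm::finite) metric_manifold \<Rightarrow> ('a \<Rightarrow> 'b) \<Rightarrow>
   (real \<Rightarrow> 'a) \<Rightarrow> (real \<Rightarrow> real ^ 'm) \<Rightarrow> real \<Rightarrow> real ^ 'm" where
  "normal_deriv M N f \<gamma> \<xi> t = normal_part M N f (\<gamma> t) (cov_deriv N (f \<circ> \<gamma>) \<xi> t)"

text \<open>
  The covariant derivative of \<open>h\<close> in the direction of \<open>velocity M \<gamma>\<close>, applied to fields \<open>Y\<close>, \<open>Z\<close>
  along \<open>\<gamma>\<close>.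
\<close>

definition cov_deriv_second_ff ::
  "('a::topological_space, 'n::finite) metric_manifold \<Rightarrow>
   ('b::topological_space, 'm::finite) metric_manifold \<Rightarrow> ('a \<Rightarrow> 'b) \<Rightarrow>
   (real \<Rightarrow> 'a) \<Rightarrow> (real \<Rightarrow> real ^ 'n) \<Rightarrow> (real \<Rightarrow> real ^ 'n) \<Rightarrow> real \<Rightarrow> real ^ 'm" where
  "cov_deriv_second_ff M N f \<gamma> Y Z t =
     normal_deriv M N f \<gamma> (\<lambda>s. second_ff M N f (\<gamma> s) (Y s) (Z s)) t
     - second_ff M N f (\<gamma> t) (cov_deriv M \<gamma> Y t) (Z t)
     - second_ff M N f (\<gamma> t) (Y t) (cov_deriv M \<gamma> Z t)"

subsection \<open>Totally geodesic submanifolds\<close>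

definition embedded_submanifold ::
  "('a::topological_space, 'n::finite) metric_manifold \<Rightarrow> nat \<Rightarrow> 'a set \<Rightarrow> bool" where
  "embedded_submanifold N k W \<longleftrightarrow> (\<forall>q\<in>W. \<exists>d S.
     is_chart d \<and> (\<forall>c\<in>atlas N. compatible c d) \<and> q \<in> fst d \<and>
     subspace S \<and> dim S = k \<and> snd d ` (W \<inter> fst d) = S \<inter> snd d ` fst d)"

definition tangent_space_of ::
  "('a::topological_space, 'n::finite) metric_manifold \<Rightarrow> 'a set \<Rightarrow> 'a \<Rightarrow> (real ^ 'n) set" where
  "tangent_space_of N W q = {velocity N c t | c I t.
     open I \<and> t \<in> I \<and> smooth_curve N I c \<and> c ` I \<subseteq> W \<and> c t = q}"

text \<open>
  Vanishing of the second fundamental form of \<open>W\<close>: covariant derivatives of tangent fields along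
  curves in \<open>W\<close> are tangent to \<open>W\<close>.  (This makes sense without nondegeneracy of the metric on \<open>W\<close>.)
\<close>

definition totally_geodesic ::
  "('a::topological_space, 'n::finite) metric_manifold \<Rightarrow> nat \<Rightarrow> 'a set \<Rightarrow> bool" where
  "totally_geodesic N k W \<longleftrightarrow> embedded_submanifold N k W \<and>
     (\<forall>I c Y. open I \<and> smooth_curve N I c \<and> c ` I \<subseteq> W \<and> smooth_along N I c Y \<and>
        (\<forall>t\<in>I. Y t \<in> tangent_space_of N W (c t)) \<longrightarrow>
        (\<forall>t\<in>I. cov_deriv N c Y t \<in> tangent_space_of N W (c t)))"

subsection \<open>Normal sections\<close>

text \<open>
  \<open>\<gamma>\<close>, defined on the open interval \<open>I\<close>, is the normal section at \<open>p\<close> in the direction of \<open>X\<close>,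
  parametrized with constant \<open>\<langle>\<gamma>', \<gamma>'\<rangle>\<close> and with parameter \<open>0\<close> at \<open>p\<close>.
\<close>

definition normal_section ::
  "('a::topological_space, 'n::finite) metric_manifold \<Rightarrow>
   ('b::topological_space, 'm::finite) metric_manifold \<Rightarrow> ('a \<Rightarrow> 'b) \<Rightarrow>
   'a \<Rightarrow> real ^ 'n \<Rightarrow> real set \<Rightarrow> (real \<Rightarrow> 'a) \<Rightarrow> bool" where
  "normal_section M N f p X I \<gamma> \<longleftrightarrow>
     metric M p X X \<in> {1, -1} \<and>
     open I \<and> is_interval I \<and> 0 \<in> I \<and> smooth_curve M I \<gamma> \<and> \<gamma> 0 = p \<and> velocity M \<gamma> 0 = X \<and>
     (\<forall>t\<in>I. metric M (\<gamma> t) (velocity M \<gamma> t) (velocity M \<gamma> t) = metric M p X X) \<and>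
     (\<exists>W U. totally_geodesic N (CARD('m) - CARD('n) + 1) W \<and> f p \<in> W \<and>
        tangent_space_of N W (f p) =
          span (insert (differential M N f p X) (normal_space M N f p)) \<and>
        open U \<and> p \<in> U \<and> \<gamma> ` I = {q\<in>U. f q \<in> W})"

text \<open>
  A normal section is determined by \<open>p\<close> and \<open>X\<close> only near \<open>p\<close>, so its properties are those that
  hold near the parameter \<open>0\<close>.
\<close>

definition planar_normal_sections ::
  "nat \<Rightarrow> ('a::topological_space, 'n::finite) metric_manifold \<Rightarrow>
   ('b::topological_space, 'm::finite) metric_manifold \<Rightarrow> ('a \<Rightarrow> 'b) \<Rightarrow> bool" where
  "planar_normal_sections d M N f \<longleftrightarrow> (\<forall>p X I \<gamma>. normal_section M N f p X I \<gamma> \<longrightarrow>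
     (\<forall>\<^sub>F t in nhds 0. \<exists>a. (\<exists>i\<le>d. a i \<noteq> 0) \<and>
        (\<Sum>i\<le>d. a i *\<^sub>R curve_deriv N (f \<circ> \<gamma>) i t) = 0))"

definition planar_geodesic_normal_sections ::
  "nat \<Rightarrow> ('a::topological_space, 'n::finite) metric_manifold \<Rightarrow>
   ('b::topological_space, 'm::finite) metric_manifold \<Rightarrow> ('a \<Rightarrow> 'b) \<Rightarrow> bool" where
  "planar_geodesic_normal_sections d M N f \<longleftrightarrow> planar_normal_sections d M N f \<and>
     (\<forall>p X I \<gamma>. normal_section M N f p X I \<gamma> \<longrightarrow>
        (\<forall>\<^sub>F t in nhds 0. cov_deriv M \<gamma> (velocity M \<gamma>) t = 0))"

text \<open>
  No sign condition is imposed on the curvatures; given \<open>V2\<close> and \<open>V3\<close> they are determined by the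
  last two equations.
\<close>

definition frenet_apparatus ::
  "('a::topological_space, 'n::finite) metric_manifold \<Rightarrow>
   ('b::topological_space, 'm::finite) metric_manifold \<Rightarrow> ('a \<Rightarrow> 'b) \<Rightarrow> real set \<Rightarrow> (real \<Rightarrow> 'a) \<Rightarrow>
   (real \<Rightarrow> real ^ 'm) \<Rightarrow> (real \<Rightarrow> real ^ 'm) \<Rightarrow> (real \<Rightarrow> real ^ 'm) \<Rightarrow>
   real \<Rightarrow> real \<Rightarrow> real \<Rightarrow> (real \<Rightarrow> real) \<Rightarrow> (real \<Rightarrow> real) \<Rightarrow> bool" where
  "frenet_apparatus M N f I \<gamma> V1 V2 V3 \<epsilon>1 \<epsilon>2 \<epsilon>3 k1 k2 \<longleftrightarrow>
     \<epsilon>1 \<in> {1, -1} \<and> \<epsilon>2 \<in> {1, -1} \<and> \<epsilon>3 \<in> {1, -1} \<and>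
     smooth_along N I (f \<circ> \<gamma>) V2 \<and> smooth_along N I (f \<circ> \<gamma>) V3 \<and>
     smooth_on I k1 \<and> smooth_on I k2 \<and>
     (\<forall>t\<in>I. let g = metric N (f (\<gamma> t)) in
        V1 t = velocity N (f \<circ> \<gamma>) t \<and>
        g (V1 t) (V1 t) = \<epsilon>1 \<and> g (V2 t) (V2 t) = \<epsilon>2 \<and> g (V3 t) (V3 t) = \<epsilon>3 \<and>
        g (V1 t) (V2 t) = 0 \<and> g (V1 t) (V3 t) = 0 \<and> g (V2 t) (V3 t) = 0 \<and>
        V2 t \<in> normal_space M N f (\<gamma> t) \<and> V3 t \<in> normal_space M N f (\<gamma> t) \<and>
        cov_deriv N (f \<circ> \<gamma>) V1 t = (\<epsilon>2 * k1 t) *\<^sub>R V2 t \<and>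
        cov_deriv N (f \<circ> \<gamma>) V2 t = - (\<epsilon>1 * k1 t) *\<^sub>R V1 t + (\<epsilon>3 * k2 t) *\<^sub>R V3 t)"

end

theory Submission
  imports Defs
begin

text \<open>
  Let \<open>X\<close> be the velocity of the normal section \<open>\<gamma>\<close>.  Since \<open>\<gamma>\<close> is a geodesic of \<open>M\<close> near the
  parameter \<open>0\<close>, the Gauss formula and the first Frenet equation give \<open>h(X, X) = \<epsilon>2 k1 V2\<close> there.
  The covariant derivative of \<open>h(X, X)\<close> in \<open>N\<close> is, by the second Frenet equation,
  \<open>\<epsilon>2 (X k1) V2 + \<epsilon>2 k1 (- \<epsilon>1 k1 X + \<epsilon>3 k2 V3)\<close>.  Its normal part is the first claim, because the
  terms \<open>h(\<nabla>\<^sub>X X, X)\<close> and \<open>h(X, \<nabla>\<^sub>X X)\<close> vanish.  For the second claim, the Weingarten formula and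
  the second Frenet equation give \<open>\<langle>h(X, w), V2\<rangle> = \<epsilon>1 k1 \<langle>X, w\<rangle>\<close> for every tangent vector \<open>w\<close>.

  What has to be supplied is the calculus behind these formulas.  The Levi-Civita connection, the
  second fundamental form, the normal part and the shape operator are definite descriptions, each
  of which must be shown to describe a unique object.  For the connection this is the Koszul
  formula (\<open>koszul\<close>), applied to the first derivatives of the metric in a chart.  For the
  second fundamental form it is \<open>gauss_formula_coord\<close>, which expresses the difference of the
  covariant derivatives of \<open>df Y\<close> and \<open>Y\<close> by the velocity and the value of \<open>Y\<close> alone, together with
  the existence of a smooth field with a prescribed value along a curve; the smoothness of such a
  field in all charts rests on the stability of \<open>C\<^sup>k\<close> maps under composition.  For the normal part
  and the shape operator it is the nondegeneracy of the metric of \<open>M\<close>.  The Weingarten formula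
  (\<open>weingarten\<close>) follows from the compatibility of the connection of \<open>N\<close> with its metric along
  curves (\<open>metric_along_curve\<close>).
\<close>

section \<open>Maps of class \<open>C\<^sup>k\<close>\<close>

lemma frechet_derivative_cong_open:
  assumes "open S" "x \<in> S" "\<And>y. y \<in> S \<Longrightarrow> f y = g y"
  shows "frechet_derivative f (at x) = frechet_derivative g (at x)"
proof -
  have "(f has_derivative D) (at x) \<longleftrightarrow> (g has_derivative D) (at x)" for D
    using assms has_derivative_transform_within_open by metis
  then show ?thesis by (simp add: frechet_derivative_def)
qed

lemma differentiable_cong_open:
  assumes "open S" "x \<in> S" "\<And>y. y \<in> S \<Longrightarrow> f y = g y" "f differentiable (at x)"
  shows "g differentiable (at x)"
  using assms has_derivative_transform_within_open unfolding differentiable_def by metis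

lemma linear_euclidean_sum:
  fixes L :: "'a::euclidean_space \<Rightarrow> 'b::real_vector"
  assumes "linear L"
  shows "L v = (\<Sum>b\<in>Basis. (v \<bullet> b) *\<^sub>R L b)"
proof -
  have "L v = L (\<Sum>b\<in>Basis. (v \<bullet> b) *\<^sub>R b)" by (simp add: euclidean_representation)
  then show ?thesis by (simp add: linear_sum[OF assms] linear_cmul[OF assms])
qed

lemma C_k_on_subset: "C_k_on k f S \<Longrightarrow> T \<subseteq> S \<Longrightarrow> C_k_on k f T"
proof (induction k arbitrary: f)
  case 0
  then show ?case using continuous_on_subset by auto
next
  case (Suc k)
  then show ?case using differentiable_on_subset by auto
qed

lemma C_k_on_cong:
  assumes "open S" "\<And>x. x \<in> S \<Longrightarrow> f x = g x" "C_k_on k f S"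
  shows "C_k_on k g S"
  using assms(2,3)
proof (induction k arbitrary: f g)
  case 0
  then show ?case by (simp cong: continuous_on_cong)
next
  case (Suc k)
  have "g differentiable_on S"
    using Suc.prems(2) differentiable_cong_open[OF assms(1) _ Suc.prems(1)] assms(1)
    by (simp add: differentiable_on_eq_differentiable_at)
  moreover have "C_k_on k (\<lambda>x. frechet_derivative g (at x) v) S" for v
  proof (rule Suc.IH)
    show "frechet_derivative f (at x) v = frechet_derivative g (at x) v" if "x \<in> S" for x
      using frechet_derivative_cong_open[OF assms(1) that Suc.prems(1)] by simp
  qed (use Suc.prems in auto)
  ultimately show ?case by simp
qed

text \<open>
  The introduction rule for one more degree of differentiability, with the derivative given
  explicitly; together with the chain, sum and product rules it yields all closure properties.
\<close>

lemma C_k_on_SucI: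
  assumes "open S" "\<And>x. x \<in> S \<Longrightarrow> (f has_derivative D x) (at x)"
    and "\<And>v. C_k_on k (\<lambda>x. D x v) S"
  shows "C_k_on (Suc k) f S"
proof -
  have "frechet_derivative f (at x) = D x" if "x \<in> S" for x
    using frechet_derivative_at[OF assms(2)[OF that]] by simp
  then have "C_k_on k (\<lambda>x. frechet_derivative f (at x) v) S" for v
    by (intro C_k_on_cong[OF assms(1) _ assms(3)[of v]]) simp
  moreover have "f differentiable_on S"
    using assms(1,2) by (auto simp: differentiable_on_eq_differentiable_at differentiable_def)
  ultimately show ?thesis by simp
qed

lemma C_k_on_Suc_imp: "C_k_on (Suc k) f S \<Longrightarrow> C_k_on k f S"
proof (induction k arbitrary: f)
  case 0
  then show ?case by (simp add: differentiable_imp_continuous_on)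
next
  case (Suc k)
  have "C_k_on k (\<lambda>x. frechet_derivative f (at x) v) S" for v
    using Suc.prems by (intro Suc.IH) simp
  then show ?case using Suc.prems by simp
qed

lemma C_k_on_const: "C_k_on k (\<lambda>x. c) S"
  by (induction k arbitrary: c) (auto simp: frechet_derivative_const)

lemma C_k_on_bounded_linear:
  assumes "bounded_linear L" "open S" "C_k_on k f S"
  shows "C_k_on k (\<lambda>x. L (f x)) S"
  using assms(3)
proof (induction k arbitrary: f)
  case 0
  then show ?case using assms(1) by (simp add: bounded_linear.continuous_on)
next
  case (Suc k)
  have d: "(f has_derivative frechet_derivative f (at x)) (at x)" if "x \<in> S" for x
    using Suc.prems assms(2) that
    by (simp add: differentiable_on_eq_differentiable_at flip: frechet_derivative_works)
  show ?case
  proof (rule C_k_on_SucI[OF assms(2)])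
    show "((\<lambda>x. L (f x)) has_derivative (\<lambda>v. L (frechet_derivative f (at x) v))) (at x)"
      if "x \<in> S" for x
      by (rule bounded_linear.has_derivative[OF assms(1) d[OF that]])
    show "C_k_on k (\<lambda>x. L (frechet_derivative f (at x) v)) S" for v
      using Suc.prems by (intro Suc.IH) simp
  qed
qed

lemma C_k_on_add:
  assumes "open S" "C_k_on k f S" "C_k_on k g S"
  shows "C_k_on k (\<lambda>x. f x + g x) S"
  using assms(2,3)
proof (induction k arbitrary: f g)
  case 0
  then show ?case by (simp add: continuous_on_add)
next
  case (Suc k)
  have d: "(f has_derivative frechet_derivative f (at x)) (at x)"
    "(g has_derivative frechet_derivative g (at x)) (at x)" if "x \<in> S" for x
    using Suc.prems assms(1) that
    by (simp_all add: differentiable_on_eq_differentiable_at flip: frechet_derivative_works)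
  show ?case
  proof (rule C_k_on_SucI[OF assms(1)])
    show "((\<lambda>x. f x + g x) has_derivative
        (\<lambda>v. frechet_derivative f (at x) v + frechet_derivative g (at x) v)) (at x)"
      if "x \<in> S" for x
      by (rule has_derivative_add[OF d(1)[OF that] d(2)[OF that]])
    show "C_k_on k (\<lambda>x. frechet_derivative f (at x) v + frechet_derivative g (at x) v) S" for v
      using Suc.prems by (intro Suc.IH) simp_all
  qed
qed

lemma C_k_on_sum:
  assumes "open S" "finite A" "\<And>a. a \<in> A \<Longrightarrow> C_k_on k (f a) S"
  shows "C_k_on k (\<lambda>x. \<Sum>a\<in>A. f a x) S"
  using assms(2,3)
proof (induction A)
  case empty
  show ?case by (simp add: C_k_on_const)
next
  case (insert a A)
  then show ?case by (simp add: C_k_on_add[OF assms(1)])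
qed

lemma C_k_on_scaleR:
  fixes f :: "'a::euclidean_space \<Rightarrow> real"
  assumes "open S" "C_k_on k f S" "C_k_on k g S"
  shows "C_k_on k (\<lambda>x. f x *\<^sub>R g x) S"
  using assms(2,3)
proof (induction k arbitrary: f g)
  case 0
  then show ?case by (simp add: continuous_on_scaleR)
next
  case (Suc k)
  have d: "(f has_derivative frechet_derivative f (at x)) (at x)"
    "(g has_derivative frechet_derivative g (at x)) (at x)" if "x \<in> S" for x
    using Suc.prems assms(1) that
    by (simp_all add: differentiable_on_eq_differentiable_at flip: frechet_derivative_works)
  show ?case
  proof (rule C_k_on_SucI[OF assms(1)])
    show "((\<lambda>x. f x *\<^sub>R g x) has_derivative (\<lambda>v. f x *\<^sub>R frechet_derivative g (at x) v
        + frechet_derivative f (at x) v *\<^sub>R g x)) (at x)"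
      if "x \<in> S" for x
      by (rule has_derivative_scaleR[OF d(1)[OF that] d(2)[OF that]])
    have "C_k_on k f S" "C_k_on k g S"
      using Suc.prems by (simp_all add: C_k_on_Suc_imp del: C_k_on.simps)
    then show "C_k_on k (\<lambda>x. f x *\<^sub>R frechet_derivative g (at x) v
        + frechet_derivative f (at x) v *\<^sub>R g x) S" for v
      using Suc.prems by (intro C_k_on_add[OF assms(1)] Suc.IH) simp_all
  qed
qed

lemma C_k_on_compose:
  fixes f :: "'a::euclidean_space \<Rightarrow> 'b::euclidean_space"
    and g :: "'b \<Rightarrow> 'c::real_normed_vector"
  assumes "open S" "open T" "f ` S \<subseteq> T" "C_k_on k f S" "C_k_on k g T"
  shows "C_k_on k (\<lambda>x. g (f x)) S"
  using assms(4,5)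
proof (induction k arbitrary: g)
  case 0
  then show ?case using assms(3) by (auto intro: continuous_on_compose2)
next
  case (Suc k)
  let ?D = "\<lambda>x v. frechet_derivative g (at (f x)) (frechet_derivative f (at x) v)"
  have df: "(f has_derivative frechet_derivative f (at x)) (at x)"
    and dg: "(g has_derivative frechet_derivative g (at (f x))) (at (f x))" if "x \<in> S" for x
    using Suc.prems assms(1-3) that
    by (auto simp: differentiable_on_eq_differentiable_at simp flip: frechet_derivative_works)
  show ?case
  proof (rule C_k_on_SucI[OF assms(1)])
    show "((\<lambda>x. g (f x)) has_derivative ?D x) (at x)" if "x \<in> S" for x
      by (rule has_derivative_compose[OF df[OF that] dg[OF that]])
    have f: "C_k_on k f S" using Suc.prems(1) by (rule C_k_on_Suc_imp)
    show "C_k_on k (\<lambda>x. ?D x v) S" for v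
      \<comment> \<open>In a basis the derivative is a finite sum of products of maps of class \<open>C\<^sup>k\<close>.\<close>
    proof (rule C_k_on_cong[OF assms(1)])
      show "C_k_on k (\<lambda>x. \<Sum>b\<in>Basis. (frechet_derivative f (at x) v \<bullet> b) *\<^sub>R
          frechet_derivative g (at (f x)) b) S"
        using Suc.prems f
        by (intro C_k_on_sum C_k_on_scaleR C_k_on_bounded_linear[OF bounded_linear_inner_left]
            Suc.IH assms(1)) simp_all
      show "(\<Sum>b\<in>Basis. (frechet_derivative f (at x) v \<bullet> b) *\<^sub>R frechet_derivative g (at (f x)) b)
          = ?D x v" if "x \<in> S" for x
        using linear_euclidean_sum[OF has_derivative_linear[OF dg[OF that]],
            of "frechet_derivative f (at x) v"] by simp
    qed
  qed
qed

lemma smooth_on_subset: "smooth_on S f \<Longrightarrow> T \<subseteq> S \<Longrightarrow> smooth_on T f"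
  unfolding smooth_on_def using C_k_on_subset by blast

lemma smooth_on_cong:
  "open S \<Longrightarrow> (\<And>x. x \<in> S \<Longrightarrow> f x = g x) \<Longrightarrow> smooth_on S f \<Longrightarrow> smooth_on S g"
  unfolding smooth_on_def using C_k_on_cong by blast

lemma smooth_on_const: "smooth_on S (\<lambda>x. c)"
  by (simp add: smooth_on_def C_k_on_const)

lemma smooth_on_compose:
  fixes f :: "'a::euclidean_space \<Rightarrow> 'b::euclidean_space"
  assumes "smooth_on S f" "smooth_on T g" "open S" "open T" "f ` S \<subseteq> T"
  shows "smooth_on S (\<lambda>x. g (f x))"
  using assms C_k_on_compose unfolding smooth_on_def by blast

lemma smooth_on_frechet_derivative:
  assumes "smooth_on S f"
  shows "smooth_on S (\<lambda>x. frechet_derivative f (at x) v)"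
  using assms C_k_on.simps(2) unfolding smooth_on_def by blast

lemma smooth_on_differentiable:
  assumes "smooth_on S f" "open S" "x \<in> S"
  shows "f differentiable (at x)"
  using assms C_k_on.simps(2)[of 0] unfolding smooth_on_def
  by (metis differentiable_on_eq_differentiable_at)

lemma smooth_on_has_derivative:
  assumes "smooth_on S f" "open S" "x \<in> S"
  shows "(f has_derivative frechet_derivative f (at x)) (at x)"
  using smooth_on_differentiable[OF assms] frechet_derivative_works by blast

section \<open>A product rule for families of linear maps\<close>

text \<open>
  The family \<open>A\<close> is differentiated pointwise only.  Linearity of \<open>A'\<close> is not assumed, since it
  follows from the uniqueness of derivatives.  Derivatives of \<open>\<langle>V, W\<rangle>\<close> and of \<open>df Y\<close> along a curve
  are instances.
\<close>

lemma has_vector_derivative_linear_family: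
  fixes A :: "real \<Rightarrow> 'a::euclidean_space \<Rightarrow> 'b::real_normed_vector"
  assumes lin: "\<forall>\<^sub>F s in nhds t. linear (A s)"
    and A': "\<And>v. ((\<lambda>s. A s v) has_vector_derivative A' v) (at t)"
    and y': "(y has_vector_derivative y') (at t)"
  shows "((\<lambda>s. A s (y s)) has_vector_derivative A t y' + A' (y t)) (at t)"
proof -
  obtain T where T: "open T" "t \<in> T" "\<And>s. s \<in> T \<Longrightarrow> linear (A s)"
    using lin unfolding eventually_nhds by blast
  have *: "((\<lambda>s. A s (z s)) has_vector_derivative
      (\<Sum>b\<in>Basis. (z t \<bullet> b) *\<^sub>R A' b + (z' \<bullet> b) *\<^sub>R A t b)) (at t)"
    if z: "(z has_vector_derivative z') (at t)" for z z'
  proof (rule has_vector_derivative_transform_within_open[OF _ T(1,2)])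
    have zb: "((\<lambda>s. z s \<bullet> b) has_real_derivative z' \<bullet> b) (at t)" for b
      using bounded_linear.has_vector_derivative[OF bounded_linear_inner_left z]
      by (simp add: has_real_derivative_iff_has_vector_derivative)
    show "((\<lambda>s. \<Sum>b\<in>Basis. (z s \<bullet> b) *\<^sub>R A s b) has_vector_derivative
        (\<Sum>b\<in>Basis. (z t \<bullet> b) *\<^sub>R A' b + (z' \<bullet> b) *\<^sub>R A t b)) (at t)"
      by (intro has_vector_derivative_sum has_vector_derivative_scaleR zb A')
    show "(\<Sum>b\<in>Basis. (z s \<bullet> b) *\<^sub>R A s b) = A s (z s)" if "s \<in> T" for s
      using linear_euclidean_sum[OF T(3)[OF that]] by metis
  qed
  have "A' (y t) = (\<Sum>b\<in>Basis. (y t \<bullet> b) *\<^sub>R A' b)"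
    using vector_derivative_unique_at[OF A' *[OF has_vector_derivative_const, of "y t"]] by simp
  moreover have "A t y' = (\<Sum>b\<in>Basis. (y' \<bullet> b) *\<^sub>R A t b)"
    by (rule linear_euclidean_sum[OF T(3)[OF T(2)]])
  ultimately show ?thesis
    using *[OF y'] by (simp add: sum.distrib add.commute)
qed

section \<open>Nondegenerate forms and the Koszul formula\<close>

lemma nondegenerate_represents:
  fixes g :: "'a::euclidean_space \<Rightarrow> 'a \<Rightarrow> real"
  assumes g: "bilinear g" "\<And>v. (\<And>w. g v w = 0) \<Longrightarrow> v = 0" and L: "linear L"
  shows "\<exists>z. \<forall>w. g z w = L w"
proof -
  \<comment> \<open>\<open>J\<close> represents the form by the Euclidean inner product; it is injective, hence surjective.\<close>
  define J where "J z = (\<Sum>b\<in>Basis. g z b *\<^sub>R b)" for z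
  have gJ: "g z w = J z \<bullet> w" for z w
  proof -
    have "linear (g z)" using g(1) by (simp add: bilinear_def)
    from linear_euclidean_sum[OF this, of w] show ?thesis
      by (simp add: J_def inner_sum_left inner_commute[of w] mult.commute)
  qed
  have "linear J"
    unfolding J_def by (rule linearI)
      (simp_all add: bilinear_ladd[OF g(1)] bilinear_lmul[OF g(1)] scaleR_add_left sum.distrib
        scaleR_sum_right)
  moreover have "inj J"
    using g(2) gJ by (simp add: linear_injective_0[OF \<open>linear J\<close>])
  ultimately have "surj J" by (simp add: linear_injective_imp_surjective)
  then obtain z where "J z = (\<Sum>b\<in>Basis. L b *\<^sub>R b)" by (metis surjD)
  then have "g z w = L w" for w
    by (simp add: gJ inner_sum_left linear_euclidean_sum[OF L, of w] inner_commute[of w]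
        mult.commute)
  then show ?thesis by blast
qed

text \<open>
  \<open>G u v w\<close> plays the role of the derivative of \<open>g v w\<close> in direction \<open>u\<close>.
\<close>

lemma koszul:
  fixes g :: "'a::euclidean_space \<Rightarrow> 'a \<Rightarrow> real"
  assumes g: "bilinear g" "\<And>v w. g v w = g w v" "\<And>v. (\<And>w. g v w = 0) \<Longrightarrow> v = 0"
    and G: "\<And>v w. linear (\<lambda>u. G u v w)" "\<And>u. bilinear (G u)" "\<And>u v w. G u v w = G u w v"
  shows "\<exists>!\<Gamma>. bilinear \<Gamma> \<and> (\<forall>u v. \<Gamma> u v = \<Gamma> v u) \<and>
    (\<forall>u v w. G u v w = g (\<Gamma> u v) w + g v (\<Gamma> u w))"
proof -
  have G_simps: "G (a + b) v w = G a v w + G b v w" "G u (a + b) w = G u a w + G u b w"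
    "G u v (a + b) = G u v a + G u v b" "G (c *\<^sub>R a) v w = c * G a v w"
    "G u (c *\<^sub>R a) w = c * G u a w" "G u v (c *\<^sub>R a) = c * G u v a" for a b c u v w
    using linear_add[OF G(1)] linear_cmul[OF G(1)]
    by (simp_all add: bilinear_ladd[OF G(2)] bilinear_lmul[OF G(2)] bilinear_radd[OF G(2)]
        bilinear_rmul[OF G(2)])
  define K where "K u v w = (G u v w + G v u w - G w u v) / 2" for u v w
  have eq: "z = z'" if "\<And>w. g z w = g z' w" for z z'
    using g(3)[of "z - z'"] that by (simp add: bilinear_lsub[OF g(1)])
  have "linear (K u v)" for u v
    by (intro linearI) (simp_all add: K_def G_simps field_simps)
  from nondegenerate_represents[OF g(1,3) this]
  obtain \<Gamma> where \<Gamma>: "\<And>u v w. g (\<Gamma> u v) w = K u v w" by metis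
  have \<Gamma>sym: "\<Gamma> u v = \<Gamma> v u" for u v
    by (rule eq) (simp add: \<Gamma> K_def G(3)[of _ u v])
  have "linear (\<lambda>u. \<Gamma> u v)" for v
    by (intro linearI eq)
       (simp_all add: bilinear_ladd[OF g(1)] bilinear_lmul[OF g(1)] \<Gamma> K_def G_simps
         field_simps)
  moreover from this have "linear (\<Gamma> u)" for u
    by (subst (asm) \<Gamma>sym)
  ultimately have bil: "bilinear \<Gamma>"
    by (simp add: bilinear_def)
  have compat: "G u v w = g (\<Gamma> u v) w + g v (\<Gamma> u w)" for u v w
    unfolding g(2)[of v] \<Gamma> K_def
    by (simp add: G(3)[of u w v] G(3)[of v w u] G(3)[of w v u] field_simps)
  have uniq: "\<Gamma>' = \<Gamma>"
    if s: "\<And>u v. \<Gamma>' u v = \<Gamma>' v u" and c: "\<And>u v w. G u v w = g (\<Gamma>' u v) w + g v (\<Gamma>' u w)" for \<Gamma>'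
  proof -
    have "g (\<Gamma>' u v) w = g (\<Gamma> u v) w" for u v w
      using c[of u v w] c[of v u w] c[of w u v] \<Gamma>[of u v w] g(2)[of v "\<Gamma>' u w"]
        g(2)[of u "\<Gamma>' v w"] g(2)[of u "\<Gamma>' w v"] s[of v u] s[of w u] s[of w v]
      by (simp add: K_def)
    then show "\<Gamma>' = \<Gamma>"
      using eq by (intro ext) blast
  qed
  show ?thesis
  proof (rule ex1I[of _ \<Gamma>])
    show "bilinear \<Gamma> \<and> (\<forall>u v. \<Gamma> u v = \<Gamma> v u) \<and>
        (\<forall>u v w. G u v w = g (\<Gamma> u v) w + g v (\<Gamma> u w))"
      by (intro conjI allI bil \<Gamma>sym compat)
  next
    fix \<Gamma>'
    assume "bilinear \<Gamma>' \<and> (\<forall>u v. \<Gamma>' u v = \<Gamma>' v u) \<and>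
        (\<forall>u v w. G u v w = g (\<Gamma>' u v) w + g v (\<Gamma>' u w))"
    then have "\<And>u v. \<Gamma>' u v = \<Gamma>' v u" "\<And>u v w. G u v w = g (\<Gamma>' u v) w + g v (\<Gamma>' u w)"
      by blast+
    then show "\<Gamma>' = \<Gamma>" by (rule uniq)
  qed
qed

section \<open>Charts and curves\<close>

lemma has_vector_derivative_compose_has_derivative:
  assumes "(x has_vector_derivative x') (at t)" "(g has_derivative g') (at (x t))"
  shows "((\<lambda>s. g (x s)) has_vector_derivative g' x') (at t)"
  using vector_derivative_diff_chain_within[of x x' t UNIV g g'] assms
  by (auto simp: o_def intro: has_derivative_at_withinI)

lemma chart_inv_chart: "is_chart c \<Longrightarrow> q \<in> fst c \<Longrightarrow> chart_inv c (snd c q) = q"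
  by (simp add: is_chart_def homeomorphism_def)

lemma open_chart_image:
  assumes "is_chart c" "open U"
  shows "open (snd c ` (fst c \<inter> U))"
proof -
  have "openin (top_of_set (snd c ` fst c)) (snd c ` (fst c \<inter> U))"
    using assms by (intro homeomorphism_imp_open_map[of "fst c" _ "snd c" "chart_inv c"])
      (auto simp: is_chart_def openin_open)
  then show ?thesis
    using assms(1) by (auto simp: is_chart_def openin_open_eq)
qed

lemma open_preimage_curve:
  assumes "continuous_on I \<gamma>" "open I" "open U"
  shows "open {t \<in> I. \<gamma> t \<in> U}"
  using continuous_open_preimage[OF assms] by (simp add: Int_def vimage_def)

context
  fixes M :: "('a::{t2_space, second_countable_topology}, 'n::finite) metric_manifold"
  assumes M: "smooth_manifold M"
begin

lemma is_chart_atlas: "c \<in> atlas M \<Longrightarrow> is_chart c"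
  using M by (simp add: smooth_manifold_def)

lemma open_atlas: "c \<in> atlas M \<Longrightarrow> open (fst c)"
  using is_chart_atlas by (simp add: is_chart_def)

lemma chart_at_atlas: "chart_at M q \<in> atlas M" and in_chart_at: "q \<in> fst (chart_at M q)"
  using M by (auto simp: smooth_manifold_def)

lemma smooth_on_coord_change:
  assumes "c \<in> atlas M" "d \<in> atlas M"
  shows "smooth_on (snd c ` (fst c \<inter> fst d)) (coord_change c d)"
  using M assms by (auto simp: smooth_manifold_def compatible_def)

lemma coord_change_has_derivative:
  assumes "c \<in> atlas M" "d \<in> atlas M" "q \<in> fst c" "q \<in> fst d"
  shows "(coord_change c d has_derivative vector_change c d q) (at (snd c q))"
  unfolding vector_change_def
  by (rule smooth_on_has_derivative[OF smooth_on_coord_change[OF assms(1,2)]])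
     (use assms in \<open>auto intro: open_chart_image is_chart_atlas open_atlas\<close>)

lemma coord_change_coord:
  "c \<in> atlas M \<Longrightarrow> q \<in> fst c \<Longrightarrow> coord_change c d (snd c q) = snd d q"
  by (simp add: coord_change_def chart_inv_chart[OF is_chart_atlas])

text \<open>The cocycle rule for the components of tangent vectors.\<close>

lemma vector_change_trans:
  assumes "c \<in> atlas M" "d \<in> atlas M" "e \<in> atlas M" "q \<in> fst c" "q \<in> fst d" "q \<in> fst e"
  shows "vector_change d e q (vector_change c d q v) = vector_change c e q v"
proof -
  let ?S = "snd c ` (fst c \<inter> fst d)"
  have "((\<lambda>x. coord_change d e (coord_change c d x)) has_derivative
      (\<lambda>v. vector_change d e q (vector_change c d q v))) (at (snd c q))"
    using has_derivative_compose[OF coord_change_has_derivative[OF assms(1,2,4,5)]]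
      coord_change_has_derivative[OF assms(2,3,5,6)] coord_change_coord[OF assms(1,4)] by simp
  then have "(coord_change c e has_derivative
      (\<lambda>v. vector_change d e q (vector_change c d q v))) (at (snd c q))"
  proof (rule has_derivative_transform_within_open)
    show "open ?S" by (intro open_chart_image is_chart_atlas open_atlas assms)
    show "snd c q \<in> ?S" using assms by blast
    show "coord_change d e (coord_change c d x) = coord_change c e x" if "x \<in> ?S" for x
      using that by (auto simp: coord_change_coord assms)
  qed
  from has_derivative_unique[OF this coord_change_has_derivative[OF assms(1,3,4,6)]]
  show ?thesis by metis
qed

lemma vector_change_self:
  assumes "c \<in> atlas M" "q \<in> fst c"
  shows "vector_change c c q v = v"
proof -
  have "((\<lambda>x. x) has_derivative vector_change c c q) (at (snd c q))"
  proof (rule has_derivative_transform_within_open[OF coord_change_has_derivative])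
    show "open (snd c ` (fst c \<inter> UNIV))"
      by (intro open_chart_image is_chart_atlas assms) simp
  qed (use assms in \<open>auto simp: coord_change_coord\<close>)
  from has_derivative_unique[OF this has_derivative_ident] show ?thesis by metis
qed

lemma from_to_chart: "c \<in> atlas M \<Longrightarrow> q \<in> fst c \<Longrightarrow> from_chart M c q (to_chart M c q v) = v"
  by (simp add: from_chart_def to_chart_def vector_change_trans vector_change_self
      chart_at_atlas in_chart_at)

lemma to_chart_at: "to_chart M (chart_at M q) q v = v"
  and from_chart_at: "from_chart M (chart_at M q) q v = v"
  by (simp_all add: from_chart_def to_chart_def vector_change_self chart_at_atlas in_chart_at)

lemma linear_to_chart: "c \<in> atlas M \<Longrightarrow> q \<in> fst c \<Longrightarrow> linear (to_chart M c q)"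
  and linear_from_chart: "c \<in> atlas M \<Longrightarrow> q \<in> fst c \<Longrightarrow> linear (from_chart M c q)"
  unfolding from_chart_def to_chart_def
  by (rule has_derivative_linear[OF coord_change_has_derivative];
      simp add: chart_at_atlas in_chart_at)+

lemma smooth_curve_nhds:
  assumes "smooth_curve M I \<gamma>" "open I" "t \<in> I"
  shows "\<forall>\<^sub>F s in nhds t. s \<in> I \<and> \<gamma> s \<in> fst (chart_at M (\<gamma> t))"
  unfolding eventually_nhds
  using open_preimage_curve[of I \<gamma> "fst (chart_at M (\<gamma> t))"] assms in_chart_at
    open_atlas[OF chart_at_atlas]
  by (intro exI[of _ "{s \<in> I. \<gamma> s \<in> fst (chart_at M (\<gamma> t))}"]) (auto simp: smooth_curve_def)

lemma smooth_along_has_vector_derivative: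
  assumes "continuous_on I \<gamma>" "open I" "t \<in> I" "smooth_along M I \<gamma> Y"
  obtains y' where
    "((\<lambda>s. to_chart M (chart_at M (\<gamma> t)) (\<gamma> s) (Y s)) has_vector_derivative y') (at t)"
proof -
  have "(\<lambda>s. to_chart M (chart_at M (\<gamma> t)) (\<gamma> s) (Y s)) differentiable (at t)"
  proof (rule smooth_on_differentiable)
    show "smooth_on {s \<in> I. \<gamma> s \<in> fst (chart_at M (\<gamma> t))}
        (\<lambda>s. to_chart M (chart_at M (\<gamma> t)) (\<gamma> s) (Y s))"
      using assms(4) chart_at_atlas by (simp add: smooth_along_def)
  qed (use assms in_chart_at in \<open>auto intro!: open_preimage_curve open_atlas chart_at_atlas\<close>)
  then show thesis using that vector_derivative_works by blast
qed

lemma smooth_curve_has_velocity: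
  assumes "smooth_curve M I \<gamma>" "open I" "t \<in> I"
  shows "((\<lambda>s. snd (chart_at M (\<gamma> t)) (\<gamma> s)) has_vector_derivative velocity M \<gamma> t) (at t)"
proof -
  have "(snd (chart_at M (\<gamma> t)) \<circ> \<gamma>) differentiable (at t)"
  proof (rule smooth_on_differentiable)
    show "smooth_on {s \<in> I. \<gamma> s \<in> fst (chart_at M (\<gamma> t))} (snd (chart_at M (\<gamma> t)) \<circ> \<gamma>)"
      using assms(1) chart_at_atlas by (simp add: smooth_curve_def)
    show "open {s \<in> I. \<gamma> s \<in> fst (chart_at M (\<gamma> t))}"
      using assms(1) by (intro open_preimage_curve open_atlas chart_at_atlas assms(2))
        (simp add: smooth_curve_def)
  qed (use assms in_chart_at in auto)
  then show ?thesis
    unfolding velocity_def using vector_derivative_works[of "snd (chart_at M (\<gamma> t)) \<circ> \<gamma>"]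
    by (simp add: o_def)
qed

end

section \<open>The Levi-Civita connection\<close>

context
  fixes M :: "('a::{t2_space, second_countable_topology}, 'n::finite) metric_manifold" and r :: nat
  assumes M: "pseudo_riemannian M r"
begin

lemma manifold_of_metric: "smooth_manifold M"
  using M by (simp add: pseudo_riemannian_def)

lemma chart_at_metric: "chart_at M q \<in> atlas M" "q \<in> fst (chart_at M q)"
  by (rule chart_at_atlas[OF manifold_of_metric] in_chart_at[OF manifold_of_metric])+

lemma bilinear_metric: "bilinear (metric M q)"
  and metric_commute: "metric M q v w = metric M q w v"
  using M by (auto simp: pseudo_riemannian_def)

lemma metric_nondegenerate: "(\<And>w. metric M q v w = 0) \<Longrightarrow> v = 0"
  using M unfolding pseudo_riemannian_def by blast

lemma metric_in_to_chart:
  assumes "c \<in> atlas M" "q \<in> fst c"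
  shows "metric_in M c (snd c q) (to_chart M c q v) (to_chart M c q w) = metric M q v w"
  by (simp add: metric_in_def chart_inv_chart[OF is_chart_atlas[OF manifold_of_metric]] assms
      from_to_chart[OF manifold_of_metric])

lemma metric_in_chart_at: "metric_in M (chart_at M q) (snd (chart_at M q) q) v w = metric M q v w"
  using metric_in_to_chart[OF chart_at_metric, of q v w]
  by (simp add: to_chart_at[OF manifold_of_metric])

lemma bilinear_metric_in:
  assumes "c \<in> atlas M" "q \<in> fst c"
  shows "bilinear (metric_in M c (snd c q))"
  unfolding bilinear_def metric_in_def
    chart_inv_chart[OF is_chart_atlas[OF manifold_of_metric assms(1)] assms(2)]
  using linear_add[OF linear_from_chart[OF manifold_of_metric assms]]
    linear_cmul[OF linear_from_chart[OF manifold_of_metric assms]]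
  by (intro conjI allI linearI)
    (simp_all add: bilinear_ladd bilinear_radd bilinear_lmul bilinear_rmul bilinear_metric)

lemma metric_in_has_derivative:
  assumes "c \<in> atlas M" "q \<in> fst c"
  shows "((\<lambda>x. metric_in M c x v w) has_derivative
    frechet_derivative (\<lambda>x. metric_in M c x v w) (at (snd c q))) (at (snd c q))"
proof (rule smooth_on_has_derivative)
  show "smooth_on (snd c ` fst c) (\<lambda>x. metric_in M c x v w)"
    using M assms by (simp add: pseudo_riemannian_def)
  show "open (snd c ` fst c)"
    using is_chart_atlas[OF manifold_of_metric assms(1)] by (simp add: is_chart_def)
qed (use assms in auto)

lemma metric_in_derivative_bilinear:
  assumes c: "c \<in> atlas M" "q \<in> fst c"
  shows "bilinear (\<lambda>v w. frechet_derivative (\<lambda>x. metric_in M c x v w) (at (snd c q)) u)"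
proof -
  let ?D = "\<lambda>v w. frechet_derivative (\<lambda>x. metric_in M c x v w) (at (snd c q))"
  have S: "open (snd c ` fst c)" "snd c q \<in> snd c ` fst c"
    using is_chart_atlas[OF manifold_of_metric c(1)] c(2) by (auto simp: is_chart_def)
  have bil: "bilinear (metric_in M c x)" if "x \<in> snd c ` fst c" for x
    using that bilinear_metric_in[OF c(1)] by auto
  note D = metric_in_has_derivative[OF c]
  have "?D (a + b) w u = ?D a w u + ?D b w u" for a b w
  proof -
    have "((\<lambda>x. metric_in M c x (a + b) w) has_derivative (\<lambda>u. ?D a w u + ?D b w u)) (at (snd c q))"
      by (rule has_derivative_transform_within_open[OF has_derivative_add[OF D D] S])
         (simp add: bilinear_ladd[OF bil])
    from fun_cong[OF has_derivative_unique[OF D this]] show ?thesis .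
  qed
  moreover have "?D v (a + b) u = ?D v a u + ?D v b u" for v a b
  proof -
    have "((\<lambda>x. metric_in M c x v (a + b)) has_derivative (\<lambda>u. ?D v a u + ?D v b u)) (at (snd c q))"
      by (rule has_derivative_transform_within_open[OF has_derivative_add[OF D D] S])
         (simp add: bilinear_radd[OF bil])
    from fun_cong[OF has_derivative_unique[OF D this]] show ?thesis .
  qed
  moreover have "?D (k *\<^sub>R a) w u = k *\<^sub>R ?D a w u" for k a w
  proof -
    have "((\<lambda>x. metric_in M c x (k *\<^sub>R a) w) has_derivative (\<lambda>u. k *\<^sub>R ?D a w u)) (at (snd c q))"
      by (rule has_derivative_transform_within_open[OF has_derivative_scaleR_right[OF D] S])
         (simp add: bilinear_lmul[OF bil])
    from fun_cong[OF has_derivative_unique[OF D this]] show ?thesis .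
  qed
  moreover have "?D v (k *\<^sub>R a) u = k *\<^sub>R ?D v a u" for v k a
  proof -
    have "((\<lambda>x. metric_in M c x v (k *\<^sub>R a)) has_derivative (\<lambda>u. k *\<^sub>R ?D v a u)) (at (snd c q))"
      by (rule has_derivative_transform_within_open[OF has_derivative_scaleR_right[OF D] S])
         (simp add: bilinear_rmul[OF bil])
    from fun_cong[OF has_derivative_unique[OF D this]] show ?thesis .
  qed
  ultimately show ?thesis
    unfolding bilinear_def by (intro conjI allI linearI)
qed

text \<open>
  The conditions in the definition of \<open>levi_civita\<close> have a unique solution, by the Koszul formula.
\<close>

lemma levi_civita_properties:
  "bilinear (levi_civita M q) \<and> (\<forall>u v. levi_civita M q u v = levi_civita M q v u) \<and>
     (\<forall>u v w.
        frechet_derivative (\<lambda>x. metric_in M (chart_at M q) x v w) (at (snd (chart_at M q) q)) u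
        = metric M q (levi_civita M q u v) w + metric M q v (levi_civita M q u w))"
proof -
  let ?c = "chart_at M q"
  have c: "?c \<in> atlas M" "q \<in> fst ?c" by (fact chart_at_metric)+
  let ?G = "\<lambda>u v w. frechet_derivative (\<lambda>x. metric_in M ?c x v w) (at (snd ?c q)) u"
  have "\<exists>!\<Gamma>. bilinear \<Gamma> \<and> (\<forall>u v. \<Gamma> u v = \<Gamma> v u) \<and>
      (\<forall>u v w. ?G u v w = metric M q (\<Gamma> u v) w + metric M q v (\<Gamma> u w))"
  proof (rule koszul)
    show "linear (\<lambda>u. ?G u v w)" for v w
      using has_derivative_linear[OF metric_in_has_derivative[OF c]] .
    show "bilinear (?G u)" for u
      by (rule metric_in_derivative_bilinear[OF c])
    show "?G u v w = ?G u w v" for u v w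
      by (simp add: metric_in_def metric_commute)
  qed (fact bilinear_metric metric_commute metric_nondegenerate)+
  from theI'[OF this] show ?thesis unfolding levi_civita_def .
qed

lemma bilinear_levi_civita: "bilinear (levi_civita M q)"
  using levi_civita_properties by blast

text \<open>
  Compatibility of the connection with the metric, for fields along a curve.  The curve and the
  fields need only be differentiable at the parameter considered.
\<close>

lemma metric_along_curve:
  assumes \<gamma>: "((\<lambda>s. snd (chart_at M (\<gamma> t)) (\<gamma> s)) has_vector_derivative velocity M \<gamma> t) (at t)"
    and near: "\<forall>\<^sub>F s in nhds t. \<gamma> s \<in> fst (chart_at M (\<gamma> t))"
    and V: "((\<lambda>s. to_chart M (chart_at M (\<gamma> t)) (\<gamma> s) (V s)) has_vector_derivative V') (at t)"
    and W: "((\<lambda>s. to_chart M (chart_at M (\<gamma> t)) (\<gamma> s) (W s)) has_vector_derivative W') (at t)"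
  shows "((\<lambda>s. metric M (\<gamma> s) (V s) (W s)) has_vector_derivative
    metric M (\<gamma> t) (cov_deriv M \<gamma> V t) (W t) + metric M (\<gamma> t) (V t) (cov_deriv M \<gamma> W t)) (at t)"
proof -
  let ?c = "chart_at M (\<gamma> t)" and ?u = "velocity M \<gamma> t" and ?g = "metric M (\<gamma> t)"
  let ?\<Gamma> = "levi_civita M (\<gamma> t)"
  let ?V = "\<lambda>s. to_chart M ?c (\<gamma> s) (V s)" and ?W = "\<lambda>s. to_chart M ?c (\<gamma> s) (W s)"
  let ?G = "\<lambda>s. metric_in M ?c (snd ?c (\<gamma> s))"
  let ?D = "\<lambda>v w. frechet_derivative (\<lambda>x. metric_in M ?c x v w) (at (snd ?c (\<gamma> t))) ?u"
  have c: "?c \<in> atlas M" "\<gamma> t \<in> fst ?c" by (fact chart_at_metric)+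
  have bil: "bilinear (?G s)" if "\<gamma> s \<in> fst ?c" for s
    by (rule bilinear_metric_in[OF c(1) that])
  have 1: "((\<lambda>s. ?G s v w) has_vector_derivative ?D v w) (at t)" for v w
    by (rule has_vector_derivative_compose_has_derivative[OF \<gamma> metric_in_has_derivative[OF c]])
  have 2: "((\<lambda>s. ?G s (?V s) w) has_vector_derivative ?G t V' w + ?D (?V t) w) (at t)" for w
    using near bil
    by (intro has_vector_derivative_linear_family[where A = "\<lambda>s v. ?G s v w"] 1 V)
       (auto simp: bilinear_def elim!: eventually_mono)
  have "((\<lambda>s. ?G s (?V s) (?W s)) has_vector_derivative
      ?G t (?V t) W' + (?G t V' (?W t) + ?D (?V t) (?W t))) (at t)"
    using near bil
    by (intro has_vector_derivative_linear_family[where A = "\<lambda>s w. ?G s (?V s) w"] 2 W)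
       (auto simp: bilinear_def elim!: eventually_mono)
  moreover have "?G t (?V t) W' + (?G t V' (?W t) + ?D (?V t) (?W t))
      = ?g (cov_deriv M \<gamma> V t) (W t) + ?g (V t) (cov_deriv M \<gamma> W t)"
  proof -
    have "?D (V t) (W t) = ?g (?\<Gamma> ?u (V t)) (W t) + ?g (V t) (?\<Gamma> ?u (W t))"
      using levi_civita_properties[of "\<gamma> t"] by blast
    then show ?thesis
      by (simp add: cov_deriv_def vector_derivative_at[OF V] vector_derivative_at[OF W]
          to_chart_at[OF manifold_of_metric] metric_in_chart_at bilinear_ladd[OF bilinear_metric]
          bilinear_radd[OF bilinear_metric])
  qed
  moreover obtain T where T: "open T" "t \<in> T" "\<And>s. s \<in> T \<Longrightarrow> \<gamma> s \<in> fst ?c"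
    using near unfolding eventually_nhds by blast
  ultimately have "((\<lambda>s. ?G s (?V s) (?W s)) has_vector_derivative
      ?g (cov_deriv M \<gamma> V t) (W t) + ?g (V t) (cov_deriv M \<gamma> W t)) (at t)"
    by simp
  then show ?thesis
    by (rule has_vector_derivative_transform_within_open[OF _ T(1,2)])
       (rule metric_in_to_chart[OF c(1) T(3)])
qed

end

section \<open>Covariant derivatives along curves\<close>

lemma cov_deriv_cong:
  assumes "\<forall>\<^sub>F s in nhds t. Y s = Z s"
  shows "cov_deriv M \<gamma> Y t = cov_deriv M \<gamma> Z t"
proof -
  have "vector_derivative (\<lambda>s. to_chart M c (\<gamma> s) (Y s)) (at t)
      = vector_derivative (\<lambda>s. to_chart M c (\<gamma> s) (Z s)) (at t)" for c
    by (intro vector_derivative_cong_eq) (use assms in \<open>auto elim: eventually_mono\<close>)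
  then show ?thesis
    using eventually_nhds_x_imp_x[OF assms] by (simp add: cov_deriv_def)
qed

lemma cov_deriv_scaleR:
  fixes M :: "('a::{t2_space, second_countable_topology}, 'n::finite) metric_manifold"
  assumes M: "pseudo_riemannian M r"
    and near: "\<forall>\<^sub>F s in nhds t. \<gamma> s \<in> fst (chart_at M (\<gamma> t))"
    and \<phi>: "(\<phi> has_real_derivative \<phi>') (at t)"
    and Y: "((\<lambda>s. to_chart M (chart_at M (\<gamma> t)) (\<gamma> s) (Y s)) has_vector_derivative Y') (at t)"
  shows "cov_deriv M \<gamma> (\<lambda>s. \<phi> s *\<^sub>R Y s) t = \<phi>' *\<^sub>R Y t + \<phi> t *\<^sub>R cov_deriv M \<gamma> Y t"
proof -
  let ?c = "chart_at M (\<gamma> t)"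
  note M' = manifold_of_metric[OF M]
  obtain T where T: "open T" "t \<in> T" "\<And>s. s \<in> T \<Longrightarrow> \<gamma> s \<in> fst ?c"
    using near unfolding eventually_nhds by blast
  have "((\<lambda>s. to_chart M ?c (\<gamma> s) (\<phi> s *\<^sub>R Y s)) has_vector_derivative
      \<phi> t *\<^sub>R Y' + \<phi>' *\<^sub>R to_chart M ?c (\<gamma> t) (Y t)) (at t)"
    by (rule has_vector_derivative_transform_within_open[OF
          has_vector_derivative_scaleR[OF \<phi> Y] T(1,2)])
       (simp add: linear_cmul[OF linear_to_chart[OF M' chart_at_atlas[OF M'] T(3)]])
  from vector_derivative_at[OF this] vector_derivative_at[OF Y] show ?thesis
    by (simp add: cov_deriv_def to_chart_at[OF M'] bilinear_rmul[OF bilinear_levi_civita[OF M]]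
        scaleR_add_right)
qed

context
  fixes M :: "('a::{t2_space, second_countable_topology}, 'n::finite) metric_manifold"
  assumes M: "smooth_manifold M"
begin

text \<open>
  The field with constant components \<open>w\<close> in a chart.  It extends an arbitrary tangent vector to a
  field along the curve.
\<close>

lemma smooth_along_chart_constant:
  assumes \<gamma>: "smooth_curve M I \<gamma>" and I: "open I" and c: "c \<in> atlas M"
  shows "smooth_along M {s \<in> I. \<gamma> s \<in> fst c} \<gamma> (\<lambda>s. from_chart M c (\<gamma> s) w)"
  unfolding smooth_along_def
proof
  fix d assume d: "d \<in> atlas M"
  let ?J = "{s \<in> I. \<gamma> s \<in> fst c \<inter> fst d}"
  have J: "open ?J"
    using \<gamma> I by (intro open_preimage_curve open_Int open_atlas[OF M] c d)
      (auto simp: smooth_curve_def)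
  have "smooth_on ?J (\<lambda>s. frechet_derivative (coord_change c d) (at ((snd c \<circ> \<gamma>) s)) w)"
  proof (rule smooth_on_compose[where f = "snd c \<circ> \<gamma>"])
    show "smooth_on ?J (snd c \<circ> \<gamma>)"
      using \<gamma> c by (auto simp: smooth_curve_def intro: smooth_on_subset)
    show "smooth_on (snd c ` (fst c \<inter> fst d)) (\<lambda>x. frechet_derivative (coord_change c d) (at x) w)"
      by (intro smooth_on_frechet_derivative smooth_on_coord_change[OF M] c d)
  qed (use J in \<open>auto intro: open_chart_image is_chart_atlas[OF M] open_atlas[OF M] c d\<close>)
  then have "smooth_on ?J (\<lambda>s. to_chart M d (\<gamma> s) (from_chart M c (\<gamma> s) w))"
  proof (rule smooth_on_cong[OF J, rotated])
    fix s assume "s \<in> ?J"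
    then show "frechet_derivative (coord_change c d) (at ((snd c \<circ> \<gamma>) s)) w
        = to_chart M d (\<gamma> s) (from_chart M c (\<gamma> s) w)"
      using vector_change_trans[OF M c chart_at_atlas[OF M] d]
      by (simp add: to_chart_def from_chart_def in_chart_at[OF M]) (simp add: vector_change_def)
  qed
  then show "smooth_on {t \<in> {s \<in> I. \<gamma> s \<in> fst c}. \<gamma> t \<in> fst d}
      (\<lambda>t. to_chart M d (\<gamma> t) (from_chart M c (\<gamma> t) w))"
    by (rule smooth_on_subset) auto
qed

lemma smooth_along_velocity:
  assumes \<gamma>: "smooth_curve M I \<gamma>" and I: "open I"
  shows "smooth_along M I \<gamma> (velocity M \<gamma>)"
  unfolding smooth_along_def
proof
  fix d assume d: "d \<in> atlas M"
  let ?J = "{s \<in> I. \<gamma> s \<in> fst d}"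
  have J: "open ?J"
    using \<gamma> I by (intro open_preimage_curve open_atlas[OF M] d) (auto simp: smooth_curve_def)
  have "smooth_on ?J (\<lambda>s. frechet_derivative (snd d \<circ> \<gamma>) (at s) 1)"
    using \<gamma> d by (intro smooth_on_frechet_derivative) (auto simp: smooth_curve_def)
  then show "smooth_on ?J (\<lambda>s. to_chart M d (\<gamma> s) (velocity M \<gamma> s))"
  proof (rule smooth_on_cong[OF J, rotated])
    fix s assume s: "s \<in> ?J"
    let ?c = "chart_at M (\<gamma> s)"
    have c: "?c \<in> atlas M" "\<gamma> s \<in> fst ?c" using chart_at_atlas[OF M] in_chart_at[OF M] by auto
    let ?K = "{u \<in> I. \<gamma> u \<in> fst ?c}"
    have K: "open ?K"
      using \<gamma> I by (intro open_preimage_curve open_atlas[OF M] c) (auto simp: smooth_curve_def)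
    have "((\<lambda>u. coord_change ?c d (snd ?c (\<gamma> u))) has_vector_derivative
        to_chart M d (\<gamma> s) (velocity M \<gamma> s)) (at s)"
      unfolding to_chart_def
      by (rule has_vector_derivative_compose_has_derivative[OF
            smooth_curve_has_velocity[OF M \<gamma> I] coord_change_has_derivative[OF M c(1) d c(2)]])
         (use s in auto)
    then have "((snd d \<circ> \<gamma>) has_vector_derivative to_chart M d (\<gamma> s) (velocity M \<gamma> s)) (at s)"
      by (rule has_vector_derivative_transform_within_open[OF _ K])
         (use s c in \<open>auto simp: coord_change_coord[OF M]\<close>)
    from frechet_derivative_at[OF this[unfolded has_vector_derivative_def], symmetric]
    show "frechet_derivative (snd d \<circ> \<gamma>) (at s) 1 = to_chart M d (\<gamma> s) (velocity M \<gamma> s)"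
      by simp
  qed
qed

end

section \<open>Smooth maps and the Gauss formula\<close>

text \<open>The coordinate expression of \<open>f\<close> in a chart \<open>c\<close> of the source and a chart \<open>d\<close> of the target.\<close>

abbreviation coord_map ::
  "('a \<Rightarrow> 'b) \<Rightarrow> ('a, 'n) chart \<Rightarrow> ('b, 'm) chart \<Rightarrow> real ^ 'n \<Rightarrow> real ^ 'm" where
  "coord_map f c d \<equiv> snd d \<circ> f \<circ> chart_inv c"

text \<open>
  The second fundamental form at \<open>p\<close> in the distinguished charts: the second derivative of the
  coordinate expression of \<open>f\<close>, corrected by the two connections.  It involves only the vectors
  \<open>u\<close> and \<open>w\<close>, no curve and no field.
\<close>

definition second_ff_coord ::
  "('a::topological_space, 'n::finite) metric_manifold \<Rightarrow>
   ('b::topological_space, 'm::finite) metric_manifold \<Rightarrow> ('a \<Rightarrow> 'b) \<Rightarrow>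
   'a \<Rightarrow> real ^ 'n \<Rightarrow> real ^ 'n \<Rightarrow> real ^ 'm" where
  "second_ff_coord M N f p u w =
     frechet_derivative (\<lambda>x. frechet_derivative
         (coord_map f (chart_at M p) (chart_at N (f p))) (at x) w) (at (snd (chart_at M p) p)) u
     + levi_civita N (f p) (differential M N f p u) (differential M N f p w)
     - differential M N f p (levi_civita M p u w)"

context
  fixes M :: "('a::{t2_space, second_countable_topology}, 'n::finite) metric_manifold"
    and N :: "('b::{t2_space, second_countable_topology}, 'm::finite) metric_manifold"
    and f :: "'a \<Rightarrow> 'b"
  assumes M: "smooth_manifold M" and N: "smooth_manifold N" and f: "smooth_map M N f"
begin

lemma open_coord_map_domain:
  assumes "c \<in> atlas M" "d \<in> atlas N"
  shows "open (snd c ` (fst c \<inter> f -` fst d))"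
proof (rule open_chart_image[OF is_chart_atlas[OF M assms(1)]])
  show "open (f -` fst d)"
    using f by (intro open_vimage open_atlas[OF N] assms) (simp add: smooth_map_def)
qed

lemma smooth_on_coord_map:
  assumes "c \<in> atlas M" "d \<in> atlas N"
  shows "smooth_on (snd c ` (fst c \<inter> f -` fst d)) (coord_map f c d)"
  using f assms by (simp add: smooth_map_def)

lemma coord_map_has_derivative:
  assumes "c \<in> atlas M" "d \<in> atlas N" "q \<in> fst c" "f q \<in> fst d"
  shows "(coord_map f c d has_derivative frechet_derivative (coord_map f c d) (at (snd c q)))
    (at (snd c q))"
  by (rule smooth_on_has_derivative[OF smooth_on_coord_map[OF assms(1,2)]])
     (use assms open_coord_map_domain in auto)

lemma coord_map_coord: "c \<in> atlas M \<Longrightarrow> q \<in> fst c \<Longrightarrow> coord_map f c d (snd c q) = snd d (f q)"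
  by (simp add: chart_inv_chart[OF is_chart_atlas[OF M]])

lemma differential_in_charts:
  assumes c: "c \<in> atlas M" "q \<in> fst c" and d: "d \<in> atlas N" "f q \<in> fst d"
  shows "to_chart N d (f q) (differential M N f q v)
    = frechet_derivative (coord_map f c d) (at (snd c q)) (to_chart M c q v)"
proof -
  let ?c = "chart_at M q" and ?d = "chart_at N (f q)"
  have c': "?c \<in> atlas M" "q \<in> fst ?c" and d': "?d \<in> atlas N" "f q \<in> fst ?d"
    using chart_at_atlas in_chart_at M N by auto
  let ?S = "snd ?c ` (fst ?c \<inter> (fst c \<inter> (f -` fst d \<inter> f -` fst ?d)))"
  have S: "open ?S" "snd ?c q \<in> ?S"
  proof -
    have "open (f -` fst d)" "open (f -` fst ?d)"
      using f by (auto intro!: open_vimage open_atlas[OF N] d d' simp: smooth_map_def)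
    then show "open ?S"
      by (intro open_chart_image is_chart_atlas[OF M] c' open_Int open_atlas[OF M] c)
  qed (use c d c' d' in auto)
  have "((\<lambda>x. coord_map f c d (coord_change ?c c x)) has_derivative
      (\<lambda>v. frechet_derivative (coord_map f c d) (at (snd c q)) (to_chart M c q v)))
      (at (snd ?c q))"
    unfolding to_chart_def
    by (rule has_derivative_compose[OF coord_change_has_derivative[OF M c'(1) c(1) c'(2) c(2)]])
       (use coord_map_has_derivative[OF c(1) d(1) c(2) d(2)] coord_change_coord[OF M c', of c]
        in \<open>simp add: o_def\<close>)
  then have 1: "((\<lambda>x. coord_change ?d d (coord_map f ?c ?d x)) has_derivative
      (\<lambda>v. frechet_derivative (coord_map f c d) (at (snd c q)) (to_chart M c q v)))
      (at (snd ?c q))"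
    by (rule has_derivative_transform_within_open[OF _ S])
       (auto simp: coord_change_coord[OF M] coord_change_coord[OF N] c c' d d'
         chart_inv_chart[OF is_chart_atlas[OF M]])
  have 2: "((\<lambda>x. coord_change ?d d (coord_map f ?c ?d x)) has_derivative
      (\<lambda>v. to_chart N d (f q) (differential M N f q v))) (at (snd ?c q))"
    unfolding to_chart_def differential_def
    by (rule has_derivative_compose[OF coord_map_has_derivative[OF c'(1) d'(1) c'(2) d'(2)]])
       (use coord_change_has_derivative[OF N d'(1) d(1) d'(2) d(2)] coord_map_coord[OF c', of ?d]
        in simp)
  show ?thesis using fun_cong[OF has_derivative_unique[OF 2 1]] .
qed

lemma linear_differential: "linear (differential M N f q)"
  unfolding differential_def
  by (rule has_derivative_linear[OF coord_map_has_derivative])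
     (simp_all add: chart_at_atlas[OF M] chart_at_atlas[OF N] in_chart_at[OF M] in_chart_at[OF N])

context
  fixes I :: "real set" and \<gamma> :: "real \<Rightarrow> 'a" and t :: real
  assumes \<gamma>: "smooth_curve M I \<gamma>" and I: "open I" "t \<in> I"
begin

lemma continuous_on_image_curve: "continuous_on I (f \<circ> \<gamma>)"
  using f \<gamma> by (intro continuous_on_compose)
    (auto simp: smooth_map_def smooth_curve_def intro: continuous_on_subset)

lemma image_curve_nhds: "\<forall>\<^sub>F s in nhds t. (f \<circ> \<gamma>) s \<in> fst (chart_at N ((f \<circ> \<gamma>) t))"
proof -
  from open_preimage_curve[OF continuous_on_image_curve I(1) open_atlas[OF N chart_at_atlas[OF N]]]
  show ?thesis
    unfolding eventually_nhds using I(2) in_chart_at[OF N, of "(f \<circ> \<gamma>) t"] by fastforce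
qed

lemma image_curve_has_velocity:
  "((\<lambda>s. snd (chart_at N ((f \<circ> \<gamma>) t)) ((f \<circ> \<gamma>) s)) has_vector_derivative
      velocity N (f \<circ> \<gamma>) t) (at t)" (is ?v)
  and velocity_image_curve: "velocity N (f \<circ> \<gamma>) t = differential M N f (\<gamma> t) (velocity M \<gamma> t)"
proof -
  let ?c = "chart_at M (\<gamma> t)" and ?d = "chart_at N (f (\<gamma> t))"
  have c: "?c \<in> atlas M" "\<gamma> t \<in> fst ?c" and d: "?d \<in> atlas N" "f (\<gamma> t) \<in> fst ?d"
    using chart_at_atlas in_chart_at M N by auto
  obtain T where T: "open T" "t \<in> T" "\<And>s. s \<in> T \<Longrightarrow> \<gamma> s \<in> fst ?c"
    using smooth_curve_nhds[OF M \<gamma> I] unfolding eventually_nhds by blast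
  have "((\<lambda>s. coord_map f ?c ?d (snd ?c (\<gamma> s))) has_vector_derivative
      differential M N f (\<gamma> t) (velocity M \<gamma> t)) (at t)"
    unfolding differential_def
    by (rule has_vector_derivative_compose_has_derivative[OF smooth_curve_has_velocity[OF M \<gamma> I]
          coord_map_has_derivative[OF c(1) d(1) c(2) d(2)]])
  then have *: "((\<lambda>s. snd ?d (f (\<gamma> s))) has_vector_derivative
      differential M N f (\<gamma> t) (velocity M \<gamma> t)) (at t)"
    by (rule has_vector_derivative_transform_within_open[OF _ T(1,2)])
       (rule coord_map_coord[OF c(1) T(3)])
  then show v: "velocity N (f \<circ> \<gamma>) t = differential M N f (\<gamma> t) (velocity M \<gamma> t)"
    by (simp add: velocity_def o_def vector_derivative_at)
  show ?v using * v by simp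
qed

lemma differential_along_has_vector_derivative:
  assumes Y: "((\<lambda>s. to_chart M (chart_at M (\<gamma> t)) (\<gamma> s) (Y s)) has_vector_derivative Y') (at t)"
  shows "((\<lambda>s. to_chart N (chart_at N ((f \<circ> \<gamma>) t)) ((f \<circ> \<gamma>) s) (differential M N f (\<gamma> s) (Y s)))
    has_vector_derivative differential M N f (\<gamma> t) Y' +
      frechet_derivative (\<lambda>x. frechet_derivative
         (coord_map f (chart_at M (\<gamma> t)) (chart_at N (f (\<gamma> t)))) (at x) (Y t))
       (at (snd (chart_at M (\<gamma> t)) (\<gamma> t))) (velocity M \<gamma> t)) (at t)"
proof -
  let ?c = "chart_at M (\<gamma> t)" and ?d = "chart_at N (f (\<gamma> t))"
  let ?x = "\<lambda>s. snd ?c (\<gamma> s)" and ?F = "coord_map f ?c ?d"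
  let ?DF = "\<lambda>s. frechet_derivative ?F (at (?x s))"
  let ?S = "snd ?c ` (fst ?c \<inter> f -` fst ?d)"
  have c: "?c \<in> atlas M" "\<gamma> t \<in> fst ?c" and d: "?d \<in> atlas N" "f (\<gamma> t) \<in> fst ?d"
    using chart_at_atlas in_chart_at M N by auto
  have "\<forall>\<^sub>F s in nhds t. \<gamma> s \<in> fst ?c \<and> f (\<gamma> s) \<in> fst ?d"
    using smooth_curve_nhds[OF M \<gamma> I] image_curve_nhds by eventually_elim simp
  then obtain T where T: "open T" "t \<in> T"
    "\<And>s. s \<in> T \<Longrightarrow> \<gamma> s \<in> fst ?c" "\<And>s. s \<in> T \<Longrightarrow> f (\<gamma> s) \<in> fst ?d"
    unfolding eventually_nhds by blast
  have "((\<lambda>s. ?DF s (to_chart M ?c (\<gamma> s) (Y s))) has_vector_derivative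
      ?DF t Y' + frechet_derivative (\<lambda>x. frechet_derivative ?F (at x) (to_chart M ?c (\<gamma> t) (Y t)))
        (at (?x t)) (velocity M \<gamma> t)) (at t)"
  proof (rule has_vector_derivative_linear_family[OF _ _ Y])
    show "\<forall>\<^sub>F s in nhds t. linear (?DF s)"
      unfolding eventually_nhds
      using T has_derivative_linear[OF coord_map_has_derivative[OF c(1) d(1)]] by blast
    fix v
    show "((\<lambda>s. ?DF s v) has_vector_derivative
        frechet_derivative (\<lambda>x. frechet_derivative ?F (at x) v) (at (?x t)) (velocity M \<gamma> t))
        (at t)"
      by (rule has_vector_derivative_compose_has_derivative[OF smooth_curve_has_velocity[OF M \<gamma> I]
            smooth_on_has_derivative[OF smooth_on_frechet_derivative[OF
                smooth_on_coord_map[OF c(1) d(1)]] open_coord_map_domain[OF c(1) d(1)]]])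
         (use c d in auto)
  qed
  moreover have "?DF t Y' = differential M N f (\<gamma> t) Y'"
    by (simp add: differential_def)
  ultimately have "((\<lambda>s. ?DF s (to_chart M ?c (\<gamma> s) (Y s))) has_vector_derivative
      differential M N f (\<gamma> t) Y' + frechet_derivative (\<lambda>x. frechet_derivative ?F (at x) (Y t))
        (at (?x t)) (velocity M \<gamma> t)) (at t)"
    by (simp add: to_chart_at[OF M])
  then show ?thesis
    by (rule has_vector_derivative_transform_within_open[OF _ T(1,2)])
       (use differential_in_charts[OF c(1) T(3) d(1) T(4)] in simp)
qed

text \<open>
  The difference of the two covariant derivatives depends only on the velocity of the curve and on
  the value of the field, since the terms with the derivative of the field cancel.
\<close>

lemma gauss_formula_coord:
  assumes "smooth_along M I \<gamma> Y"
  shows "cov_deriv N (f \<circ> \<gamma>) (\<lambda>s. differential M N f (\<gamma> s) (Y s)) t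
      - differential M N f (\<gamma> t) (cov_deriv M \<gamma> Y t)
    = second_ff_coord M N f (\<gamma> t) (velocity M \<gamma> t) (Y t)"
proof -
  obtain Y' where Y':
    "((\<lambda>s. to_chart M (chart_at M (\<gamma> t)) (\<gamma> s) (Y s)) has_vector_derivative Y') (at t)"
    using smooth_along_has_vector_derivative[OF M _ I assms] \<gamma> by (auto simp: smooth_curve_def)
  show ?thesis
    using vector_derivative_at[OF Y']
      vector_derivative_at[OF differential_along_has_vector_derivative[OF Y']]
    by (simp add: cov_deriv_def second_ff_coord_def velocity_image_curve
        linear_add[OF linear_differential])
qed

end

text \<open>
  The definite description in \<open>second_ff\<close> determines a vector: all curves and fields give the same
  value, and the field with constant components shows that some curve and field exist.
\<close>

lemma second_ff_velocity:
  assumes \<gamma>: "smooth_curve M I \<gamma>" and I: "open I" "t \<in> I"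
  shows "second_ff M N f (\<gamma> t) (velocity M \<gamma> t) w
    = second_ff_coord M N f (\<gamma> t) (velocity M \<gamma> t) w"
  unfolding second_ff_def
proof (rule the_equality)
  show "\<forall>J \<beta> Y s. open J \<and> s \<in> J \<and> smooth_curve M J \<beta> \<and> \<beta> s = \<gamma> t \<and>
      velocity M \<beta> s = velocity M \<gamma> t \<and> smooth_along M J \<beta> Y \<and> Y s = w \<longrightarrow>
      second_ff_coord M N f (\<gamma> t) (velocity M \<gamma> t) w
      = cov_deriv N (f \<circ> \<beta>) (\<lambda>s. differential M N f (\<beta> s) (Y s)) s
        - differential M N f (\<gamma> t) (cov_deriv M \<beta> Y s)"
  proof (intro allI impI, elim conjE)
    fix J \<beta> Y s
    assume *: "open J" "s \<in> J" "smooth_curve M J \<beta>" "\<beta> s = \<gamma> t"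
      "velocity M \<beta> s = velocity M \<gamma> t" "smooth_along M J \<beta> Y" "Y s = w"
    from gauss_formula_coord[OF *(3,1,2,6)] *(4,5,7)
    show "second_ff_coord M N f (\<gamma> t) (velocity M \<gamma> t) w
      = cov_deriv N (f \<circ> \<beta>) (\<lambda>s. differential M N f (\<beta> s) (Y s)) s
        - differential M N f (\<gamma> t) (cov_deriv M \<beta> Y s)" by simp
  qed
next
  fix u
  assume u: "\<forall>J \<beta> Y s. open J \<and> s \<in> J \<and> smooth_curve M J \<beta> \<and> \<beta> s = \<gamma> t \<and>
      velocity M \<beta> s = velocity M \<gamma> t \<and> smooth_along M J \<beta> Y \<and> Y s = w \<longrightarrow>
      u = cov_deriv N (f \<circ> \<beta>) (\<lambda>s. differential M N f (\<beta> s) (Y s)) s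
        - differential M N f (\<gamma> t) (cov_deriv M \<beta> Y s)"
  let ?c = "chart_at M (\<gamma> t)"
  let ?J = "{s \<in> I. \<gamma> s \<in> fst ?c}" and ?Y = "\<lambda>s. from_chart M ?c (\<gamma> s) w"
  have c: "?c \<in> atlas M" "\<gamma> t \<in> fst ?c" using chart_at_atlas[OF M] in_chart_at[OF M] by auto
  have J: "open ?J" "t \<in> ?J"
    using \<gamma> I c by (auto intro!: open_preimage_curve open_atlas[OF M] simp: smooth_curve_def)
  have \<gamma>J: "smooth_curve M ?J \<gamma>"
    using \<gamma> by (auto simp: smooth_curve_def intro: continuous_on_subset elim!: smooth_on_subset)
  have Y: "smooth_along M ?J \<gamma> ?Y" "?Y t = w"
    by (rule smooth_along_chart_constant[OF M \<gamma> I(1) c(1)]) (rule from_chart_at[OF M])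
  have "u = cov_deriv N (f \<circ> \<gamma>) (\<lambda>s. differential M N f (\<gamma> s) (?Y s)) t
        - differential M N f (\<gamma> t) (cov_deriv M \<gamma> ?Y t)"
    using u[rule_format, of ?J t \<gamma> ?Y] J \<gamma>J Y by blast
  then show "u = second_ff_coord M N f (\<gamma> t) (velocity M \<gamma> t) w"
    using gauss_formula_coord[OF \<gamma>J J Y(1)] Y(2) by simp
qed

lemma gauss_formula:
  assumes "smooth_curve M I \<gamma>" "open I" "t \<in> I" "smooth_along M I \<gamma> Y"
  shows "cov_deriv N (f \<circ> \<gamma>) (\<lambda>s. differential M N f (\<gamma> s) (Y s)) t
    = differential M N f (\<gamma> t) (cov_deriv M \<gamma> Y t)
      + second_ff M N f (\<gamma> t) (velocity M \<gamma> t) (Y t)"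
  using gauss_formula_coord[OF assms] second_ff_velocity[OF assms(1-3), of "Y t"]
  by (simp add: algebra_simps)

end

section \<open>The Weingarten formula\<close>

context
  fixes M :: "('a::{t2_space, second_countable_topology}, 'n::finite) metric_manifold"
    and N :: "('b::{t2_space, second_countable_topology}, 'm::finite) metric_manifold"
    and f :: "'a \<Rightarrow> 'b" and r s :: nat
  assumes pM: "pseudo_riemannian M r" and pN: "pseudo_riemannian N s"
    and iso: "isometric_immersion M N f"
begin

lemma smooth_immersion:
  shows "smooth_manifold M" "smooth_manifold N" "smooth_map M N f"
  using pM pN iso by (auto simp: pseudo_riemannian_def isometric_immersion_def)

lemma metric_differential:
  "metric N (f q) (differential M N f q v) (differential M N f q w) = metric M q v w"
  using iso by (simp add: isometric_immersion_def)

lemma subspace_normal_space: "subspace (normal_space M N f q)"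
  by (simp add: subspace_def normal_space_def bilinear_rzero bilinear_radd bilinear_rmul
      bilinear_metric[OF pN])

text \<open>
  The metric of \<open>M\<close> is nondegenerate, so that a vector which is both tangent and normal vanishes and
  the normal part is unique.
\<close>

lemma normal_part_eq:
  assumes \<xi>: "\<xi> \<in> normal_space M N f q"
  shows "normal_part M N f q (differential M N f q u + \<xi>) = \<xi>"
  unfolding normal_part_def
proof (rule the_equality)
  fix \<zeta>
  assume \<zeta>: "\<zeta> \<in> normal_space M N f q \<and>
    differential M N f q u + \<xi> - \<zeta> \<in> range (differential M N f q)"
  then obtain b where b: "differential M N f q u + \<xi> - \<zeta> = differential M N f q b" by blast
  note lin = linear_differential[OF smooth_immersion]
  have d: "\<zeta> - \<xi> = differential M N f q (u - b)"
    using b by (simp add: linear_diff[OF lin] algebra_simps)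
  have "\<zeta> - \<xi> \<in> normal_space M N f q"
    using \<zeta> \<xi> subspace_normal_space by (simp add: subspace_diff)
  then have "metric M q (u - b) v = 0" for v
    using metric_differential[of q v "u - b"] unfolding d
    by (simp add: normal_space_def metric_commute[OF pM, of q v])
  then have "u - b = 0" by (rule metric_nondegenerate[OF pM])
  then show "\<zeta> = \<xi>" using d by (simp add: linear_0[OF lin])
qed (use \<xi> in simp)

lemma second_ff_coord_zero:
  "second_ff_coord M N f q 0 w = 0" "second_ff_coord M N f q u 0 = 0"
proof -
  let ?c = "chart_at M q" and ?d = "chart_at N (f q)"
  let ?F = "coord_map f ?c ?d" and ?S = "snd ?c ` (fst ?c \<inter> f -` fst ?d)"
  have c: "?c \<in> atlas M" "q \<in> fst ?c" and d: "?d \<in> atlas N" "f q \<in> fst ?d"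
    using chart_at_atlas in_chart_at smooth_immersion(1,2) by auto
  have S: "open ?S" "snd ?c q \<in> ?S"
    using open_coord_map_domain[OF smooth_immersion c(1) d(1)] c d by auto
  have "linear (frechet_derivative (\<lambda>x. frechet_derivative ?F (at x) w) (at (snd ?c q)))"
    by (rule has_derivative_linear[OF smooth_on_has_derivative[OF smooth_on_frechet_derivative[OF
              smooth_on_coord_map[OF smooth_immersion c(1) d(1)]] S]])
  then show "second_ff_coord M N f q 0 w = 0"
    by (simp add: second_ff_coord_def linear_0 linear_differential[OF smooth_immersion]
        bilinear_lzero[OF bilinear_levi_civita[OF pM]]
        bilinear_lzero[OF bilinear_levi_civita[OF pN]])
  have "frechet_derivative (\<lambda>x. frechet_derivative ?F (at x) 0) (at (snd ?c q))
      = frechet_derivative (\<lambda>x. 0) (at (snd ?c q))"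
  proof (rule frechet_derivative_cong_open[OF S])
    show "frechet_derivative ?F (at x) 0 = 0" if "x \<in> ?S" for x
      using that by (intro linear_0 has_derivative_linear[OF smooth_on_has_derivative[OF
              smooth_on_coord_map[OF smooth_immersion c(1) d(1)] S(1)]])
  qed
  then show "second_ff_coord M N f q u 0 = 0"
    by (simp add: second_ff_coord_def linear_0 linear_differential[OF smooth_immersion]
        frechet_derivative_const bilinear_rzero[OF bilinear_levi_civita[OF pM]]
        bilinear_rzero[OF bilinear_levi_civita[OF pN]])
qed

lemma second_ff_zero_left: "second_ff M N f q 0 w = 0"
proof -
  \<comment> \<open>The constant curve has velocity \<open>0\<close>.\<close>
  have "smooth_curve M UNIV (\<lambda>t. q)"
    by (simp add: smooth_curve_def o_def smooth_on_const)
  moreover have "velocity M (\<lambda>t. q) 0 = 0"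
    by (simp add: velocity_def o_def)
  ultimately show ?thesis
    using second_ff_velocity[OF smooth_immersion, of UNIV "\<lambda>t. q" 0 w]
    by (simp add: second_ff_coord_zero)
qed

lemma second_ff_zero_right:
  "smooth_curve M I \<gamma> \<Longrightarrow> open I \<Longrightarrow> t \<in> I \<Longrightarrow>
    second_ff M N f (\<gamma> t) (velocity M \<gamma> t) 0 = 0"
  by (simp add: second_ff_velocity[OF smooth_immersion] second_ff_coord_zero)

lemma shape_op_eqI:
  assumes "\<And>w. metric M q u w = metric N (f q) (second_ff M N f q v w) \<xi>"
  shows "shape_op M N f q \<xi> v = u"
  unfolding shape_op_def
proof (rule the_equality)
  fix u' assume "\<forall>w. metric M q u' w = metric N (f q) (second_ff M N f q v w) \<xi>"
  then have "metric M q (u' - u) w = 0" for w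
    using assms by (simp add: bilinear_lsub[OF bilinear_metric[OF pM]])
  then have "u' - u = 0" by (rule metric_nondegenerate[OF pM])
  then show "u' = u" by simp
qed (use assms in simp)

text \<open>
  \<open>\<langle>h(X, w), \<xi>\<rangle> = - \<langle>df w, \<nabla>\<^sub>X \<xi>\<rangle>\<close>, from differentiating \<open>\<langle>df Y, \<xi>\<rangle> = 0\<close> for an extension \<open>Y\<close> of \<open>w\<close>
  along the curve.
\<close>

lemma weingarten:
  assumes \<gamma>: "smooth_curve M I \<gamma>" and I: "open I" "t \<in> I"
    and \<xi>: "smooth_along N I (f \<circ> \<gamma>) \<xi>" "\<And>u. u \<in> I \<Longrightarrow> \<xi> u \<in> normal_space M N f (\<gamma> u)"
  shows "metric N (f (\<gamma> t)) (second_ff M N f (\<gamma> t) (velocity M \<gamma> t) w) (\<xi> t)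
    = - metric N (f (\<gamma> t)) (differential M N f (\<gamma> t) w) (cov_deriv N (f \<circ> \<gamma>) \<xi> t)"
proof -
  let ?c = "chart_at M (\<gamma> t)"
  let ?J = "{u \<in> I. \<gamma> u \<in> fst ?c}" and ?Y = "\<lambda>u. from_chart M ?c (\<gamma> u) w"
  let ?W = "\<lambda>u. differential M N f (\<gamma> u) (?Y u)"
  note bil = bilinear_metric[OF pN]
  have c: "?c \<in> atlas M" "\<gamma> t \<in> fst ?c" by (fact chart_at_metric[OF pM])+
  have J: "open ?J" "t \<in> ?J"
    using \<gamma> I c
    by (auto intro!: open_preimage_curve open_atlas[OF smooth_immersion(1)] simp: smooth_curve_def)
  have \<gamma>J: "smooth_curve M ?J \<gamma>"
    using \<gamma> by (auto simp: smooth_curve_def intro: continuous_on_subset elim!: smooth_on_subset)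
  have Y: "smooth_along M ?J \<gamma> ?Y" "?Y t = w"
    by (rule smooth_along_chart_constant[OF smooth_immersion(1) \<gamma> I(1) c(1)])
       (rule from_chart_at[OF smooth_immersion(1)])
  obtain Y' where Y': "((\<lambda>u. to_chart M ?c (\<gamma> u) (?Y u)) has_vector_derivative Y') (at t)"
    using smooth_along_has_vector_derivative[OF smooth_immersion(1) _ J Y(1)] \<gamma>J
    by (auto simp: smooth_curve_def)
  obtain \<xi>' where \<xi>': "((\<lambda>u. to_chart N (chart_at N ((f \<circ> \<gamma>) t)) ((f \<circ> \<gamma>) u) (\<xi> u))
      has_vector_derivative \<xi>') (at t)"
    using smooth_along_has_vector_derivative[OF smooth_immersion(2)
        continuous_on_image_curve[OF smooth_immersion \<gamma> I] I \<xi>(1)] by auto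
  have D: "((\<lambda>u. metric N ((f \<circ> \<gamma>) u) (?W u) (\<xi> u)) has_vector_derivative
      metric N ((f \<circ> \<gamma>) t) (cov_deriv N (f \<circ> \<gamma>) ?W t) (\<xi> t)
      + metric N ((f \<circ> \<gamma>) t) (?W t) (cov_deriv N (f \<circ> \<gamma>) \<xi> t)) (at t)"
    by (rule metric_along_curve[OF pN image_curve_has_velocity[OF smooth_immersion \<gamma> I]
          image_curve_nhds[OF smooth_immersion \<gamma> I]
          differential_along_has_vector_derivative[OF smooth_immersion \<gamma> I Y'] \<xi>'])
  have "((\<lambda>u. metric N ((f \<circ> \<gamma>) u) (?W u) (\<xi> u)) has_vector_derivative 0) (at t)"
    by (rule has_vector_derivative_transform_within_open[OF has_vector_derivative_const I, of 0])
       (use \<xi>(2) in \<open>simp add: normal_space_def\<close>)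
  from vector_derivative_unique_at[OF D this]
  have "metric N (f (\<gamma> t)) (cov_deriv N (f \<circ> \<gamma>) ?W t) (\<xi> t)
      = - metric N (f (\<gamma> t)) (differential M N f (\<gamma> t) w) (cov_deriv N (f \<circ> \<gamma>) \<xi> t)"
    by (simp add: Y(2))
  moreover have "metric N (f (\<gamma> t)) (differential M N f (\<gamma> t) v) (\<xi> t) = 0" for v
    using \<xi>(2)[OF I(2)] by (simp add: normal_space_def)
  ultimately show ?thesis
    using gauss_formula[OF smooth_immersion \<gamma>J J Y(1)] by (simp add: Y(2) bilinear_ladd[OF bil])
qed

end

section \<open>Normal sections that are geodesics\<close>

theorem proposition13:
  fixes M :: "('a::{t2_space, second_countable_topology}, 'n::finite) metric_manifold"
    and N :: "('b::{t2_space, second_countable_topology}, 'm::finite) metric_manifold"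
    and f :: "'a \<Rightarrow> 'b" and r s :: nat
    and p :: 'a and X :: "real ^ 'n" and I :: "real set" and \<gamma> :: "real \<Rightarrow> 'a"
    and V1 V2 V3 :: "real \<Rightarrow> real ^ 'm" and \<epsilon>1 \<epsilon>2 \<epsilon>3 :: real and k1 k2 :: "real \<Rightarrow> real"
  assumes "pseudo_riemannian M r" and "connected (UNIV :: 'a set)"
    and "pseudo_riemannian N s"
    and "isometric_immersion M N f"
    and "planar_geodesic_normal_sections 3 M N f"
    and "normal_section M N f p X I \<gamma>"
    and "frenet_apparatus M N f I \<gamma> V1 V2 V3 \<epsilon>1 \<epsilon>2 \<epsilon>3 k1 k2"
  shows "\<forall>\<^sub>F t in nhds 0.
      cov_deriv_second_ff M N f \<gamma> (velocity M \<gamma>) (velocity M \<gamma>) t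
        = (\<epsilon>2 * deriv k1 t) *\<^sub>R V2 t + (\<epsilon>2 * \<epsilon>3 * k1 t * k2 t) *\<^sub>R V3 t
      \<and> shape_op M N f (\<gamma> t)
          (second_ff M N f (\<gamma> t) (velocity M \<gamma> t) (velocity M \<gamma> t)) (velocity M \<gamma> t)
        = (\<epsilon>1 * \<epsilon>2 * (k1 t)\<^sup>2) *\<^sub>R velocity M \<gamma> t"
proof -
  note imm = assms(1,3,4)
  note sm = smooth_immersion[OF imm]
  let ?X = "velocity M \<gamma>" and ?h = "\<lambda>t. second_ff M N f (\<gamma> t) (velocity M \<gamma> t) (velocity M \<gamma> t)"
  let ?df = "\<lambda>t. differential M N f (\<gamma> t)"
  have \<gamma>: "smooth_curve M I \<gamma>" and I: "open I" "0 \<in> I"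
    using assms(6) by (auto simp: normal_section_def)
  have V2: "smooth_along N I (f \<circ> \<gamma>) V2" and k1: "smooth_on I k1"
    using assms(7) by (auto simp: frenet_apparatus_def)
  have F: "V1 t = velocity N (f \<circ> \<gamma>) t"
    "V2 t \<in> normal_space M N f (\<gamma> t)" "V3 t \<in> normal_space M N f (\<gamma> t)"
    "cov_deriv N (f \<circ> \<gamma>) V1 t = (\<epsilon>2 * k1 t) *\<^sub>R V2 t"
    "cov_deriv N (f \<circ> \<gamma>) V2 t = - (\<epsilon>1 * k1 t) *\<^sub>R V1 t + (\<epsilon>3 * k2 t) *\<^sub>R V3 t"
    if "t \<in> I" for t
    using assms(7) that by (auto simp: frenet_apparatus_def Let_def)
  have V1: "V1 t = ?df t (?X t)" if "t \<in> I" for t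
    using F(1)[OF that] velocity_image_curve[OF sm \<gamma> I(1) that] by simp
  have h: "?h t = (\<epsilon>2 * k1 t) *\<^sub>R V2 t" if "t \<in> I" "cov_deriv M \<gamma> ?X t = 0" for t
  proof -
    have "cov_deriv N (f \<circ> \<gamma>) (\<lambda>u. ?df u (?X u)) t = cov_deriv N (f \<circ> \<gamma>) V1 t"
      using eventually_nhds_in_open[OF I(1) that(1)] V1
      by (intro cov_deriv_cong) (auto elim: eventually_mono)
    then show ?thesis
      using gauss_formula[OF sm \<gamma> I(1) that(1) smooth_along_velocity[OF sm(1) \<gamma> I(1)]]
        F(4)[OF that(1)] that(2) by (simp add: linear_0 linear_differential[OF sm])
  qed
  \<comment> \<open>To differentiate \<open>h(X, X)\<close> at \<open>t\<close>, its expression in the Frenet frame must hold near \<open>t\<close>.\<close>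
  have "\<forall>\<^sub>F t in nhds 0. t \<in> I \<and> cov_deriv M \<gamma> ?X t = 0"
    using assms(5,6) eventually_nhds_in_open[OF I]
    by (auto simp: planar_geodesic_normal_sections_def intro: eventually_conj)
  then have "\<forall>\<^sub>F t in nhds 0. \<forall>\<^sub>F u in nhds t. u \<in> I \<and> cov_deriv M \<gamma> ?X u = 0"
    by (simp only: eventually_eventually)
  then show ?thesis
  proof (rule eventually_mono)
    fix t assume near: "\<forall>\<^sub>F u in nhds t. u \<in> I \<and> cov_deriv M \<gamma> ?X u = 0"
    then have t: "t \<in> I" and geodesic: "cov_deriv M \<gamma> ?X t = 0"
      using eventually_nhds_x_imp_x by blast+
    have "k1 differentiable (at t)"
      by (rule smooth_on_differentiable[OF k1 I(1) t])
    then have k1': "(k1 has_real_derivative deriv k1 t) (at t)"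
      using DERIV_deriv_iff_real_differentiable by blast
    obtain V' where V': "((\<lambda>u. to_chart N (chart_at N ((f \<circ> \<gamma>) t)) ((f \<circ> \<gamma>) u) (V2 u))
        has_vector_derivative V') (at t)"
      using smooth_along_has_vector_derivative[OF sm(2)
          continuous_on_image_curve[OF sm \<gamma> I(1) t] I(1) t V2] by auto
    \<comment> \<open>Separate \<open>cov_deriv\<close> of \<open>h(X, X)\<close> into its tangential and its normal part.\<close>
    have "cov_deriv N (f \<circ> \<gamma>) ?h t = cov_deriv N (f \<circ> \<gamma>) (\<lambda>u. (\<epsilon>2 * k1 u) *\<^sub>R V2 u) t"
      using near h by (intro cov_deriv_cong) (auto elim: eventually_mono)
    also have "\<dots> = (\<epsilon>2 * deriv k1 t) *\<^sub>R V2 t + (\<epsilon>2 * k1 t) *\<^sub>R cov_deriv N (f \<circ> \<gamma>) V2 t"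
      by (rule cov_deriv_scaleR[OF assms(3) image_curve_nhds[OF sm \<gamma> I(1) t]
            DERIV_cmult[OF k1'] V'])
    also have "\<dots> = ?df t (- (\<epsilon>1 * \<epsilon>2 * (k1 t)\<^sup>2) *\<^sub>R ?X t)
        + ((\<epsilon>2 * deriv k1 t) *\<^sub>R V2 t + (\<epsilon>2 * \<epsilon>3 * k1 t * k2 t) *\<^sub>R V3 t)"
      unfolding F(5)[OF t] V1[OF t] linear_cmul[OF linear_differential[OF sm]]
      by (simp add: algebra_simps power2_eq_square)
    finally have "normal_deriv M N f \<gamma> ?h t
        = (\<epsilon>2 * deriv k1 t) *\<^sub>R V2 t + (\<epsilon>2 * \<epsilon>3 * k1 t * k2 t) *\<^sub>R V3 t"
      unfolding normal_deriv_def
      using F(2,3)[OF t] subspace_normal_space[OF imm]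
      by (simp add: normal_part_eq[OF imm] subspace_add subspace_scale)
    moreover have "shape_op M N f (\<gamma> t) (?h t) (?X t) = (\<epsilon>1 * \<epsilon>2 * (k1 t)\<^sup>2) *\<^sub>R ?X t"
    proof (rule shape_op_eqI[OF imm])
      fix w
      let ?g = "metric N (f (\<gamma> t))"
      note bil = bilinear_metric[OF assms(3)] bilinear_metric[OF assms(1)]
      have "?g (second_ff M N f (\<gamma> t) (?X t) w) (V2 t)
          = - ?g (?df t w) (cov_deriv N (f \<circ> \<gamma>) V2 t)"
        by (rule weingarten[OF imm \<gamma> I(1) t V2 F(2)])
      also have "\<dots> = \<epsilon>1 * k1 t * metric M (\<gamma> t) w (?X t)"
        using F(3)[OF t] unfolding F(5)[OF t] V1[OF t]
        by (simp add: normal_space_def bilinear_radd[OF bil(1)] bilinear_rmul[OF bil(1)]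
            bilinear_rsub[OF bil(1)] metric_differential[OF imm])
      finally show "metric M (\<gamma> t) ((\<epsilon>1 * \<epsilon>2 * (k1 t)\<^sup>2) *\<^sub>R ?X t) w
          = ?g (second_ff M N f (\<gamma> t) (?X t) w) (?h t)"
        by (simp add: h[OF t geodesic] bilinear_rmul[OF bil(1)] bilinear_lmul[OF bil(2)]
            metric_commute[OF assms(1), of _ w] power2_eq_square)
    qed
    ultimately show "cov_deriv_second_ff M N f \<gamma> ?X ?X t
        = (\<epsilon>2 * deriv k1 t) *\<^sub>R V2 t + (\<epsilon>2 * \<epsilon>3 * k1 t * k2 t) *\<^sub>R V3 t
      \<and> shape_op M N f (\<gamma> t) (?h t) (?X t) = (\<epsilon>1 * \<epsilon>2 * (k1 t)\<^sup>2) *\<^sub>R ?X t"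
      by (simp add: cov_deriv_second_ff_def geodesic second_ff_zero_left[OF imm]
          second_ff_zero_right[OF imm \<gamma> I(1) t])
  qed
qed

end
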